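(* Let $\mathbf{U}_k\in\mathbb{R}^{m\times k}$ satisfy $\mathbf{U}_k^\top\mathbf{U}_k=\mathbf{I}$. There exists an algorithm that, given a set of SV-LCOV tuples $\{(\mathbf{b}_1,\mathbf{c}_1)_{\mathbf{U}_k},\dots,(\mathbf{b}_s,\mathbf{c}_s)_{\mathbf{U}_k}\}$, obtains an orthonormal basis of (the span of) this set in $O\left(\left(\sum_{i=1}^s nnz(\mathbf{b}_i)+k\right)s^2\right)$ time.
   Context: For $\mathbf{U}_k\in\mathbb{R}^{m\times k}$ with $\mathbf{U}_k^\top\mathbf{U}_k=\mathbf{I}$ and a sparse vector $\mathbf{b}\in\mathbb{R}^m$, the SV-LCOV form of the vector $\mathbf{z}=(\mathbf{I}-\mathbf{U}_k\mathbf{U}_k^\top)\mathbf{b}=\mathbf{b}-\mathbf{U}_k\mathbf{c}$ is the tuple denoted $(\mathbf{b},\mathbf{c})_{\mathbf{U}_k}$, where $\mathbf{c}=\mathbf{U}_k^\top\mathbf{b}\in\mathbb{R}^k$. A tuple stands for the vector $\mathbf{b}-\mathbf{U}_k\mathbf{c}$ it represents; tuples representing the same vector are identified. Operations on SV-LCOV tuples are defined by $\alpha(\mathbf{b},\mathbf{c})_{\mathbf{U}_k}=(\alpha\mathbf{b},\alpha\mathbf{c})_{\mathbf{U}_k}$ for $\alpha\in\mathbb{R}$, $(\mathbf{b}_1,\mathbf{c}_1)_{\mathbf{U}_k}+(\mathbf{b}_2,\mathbf{c}_2)_{\mathbf{U}_k}=(\mathbf{b}_1+\mathbf{b}_2,\mathbf{c}_1+\mathbf{c}_2)_{\mathbf{U}_k}$,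 and $\langle(\mathbf{b}_1,\mathbf{c}_1)_{\mathbf{U}_k},(\mathbf{b}_2,\mathbf{c}_2)_{\mathbf{U}_k}\rangle=\langle\mathbf{b}_1,\mathbf{b}_2\rangle-\langle\mathbf{c}_1,\mathbf{c}_2\rangle$, with the standard dot product on the right. Orthonormality and span are with respect to these operations, and the basis is output as SV-LCOV tuples. $nnz(\cdot)$ denotes the number of nonzero entries. The first components of tuples are stored in sparse form, the second components in dense form, and time counts operations with arithmetic operations (including square roots) on real numbers having unit cost. *)

theory Defs
  imports "Jordan_Normal_Form.Matrix"
begin

section \<open>SV-LCOV tuples\<close>

type_synonym svl = "real vec \<times> real vec"

definition is_svl :: "real mat \<Rightarrow> svl \<Rightarrow> bool" where
  "is_svl U t \<longleftrightarrow> fst t \<in> carrier_vec (dim_row U) \<and> snd t = transpose_mat U *\<^sub>v fst t"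

definition svl_vec :: "real mat \<Rightarrow> svl \<Rightarrow> real vec" where
  "svl_vec U t = fst t - U *\<^sub>v snd t"

text \<open>Tuples are identified when they represent the same vector.\<close>

definition svl_eq :: "real mat \<Rightarrow> svl \<Rightarrow> svl \<Rightarrow> bool" where
  "svl_eq U t t' \<longleftrightarrow> svl_vec U t = svl_vec U t'"

definition svl_smult :: "real \<Rightarrow> svl \<Rightarrow> svl" where
  "svl_smult a t = (a \<cdot>\<^sub>v fst t, a \<cdot>\<^sub>v snd t)"

definition svl_add :: "svl \<Rightarrow> svl \<Rightarrow> svl" where
  "svl_add t t' = (fst t + fst t', snd t + snd t')"

definition svl_inner :: "svl \<Rightarrow> svl \<Rightarrow> real" where
  "svl_inner t t' = fst t \<bullet> fst t' - snd t \<bullet> snd t'"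

definition svl_zero :: "real mat \<Rightarrow> svl" where
  "svl_zero U = (0\<^sub>v (dim_row U), 0\<^sub>v (dim_col U))"

definition svl_lincomb :: "real mat \<Rightarrow> real list \<Rightarrow> svl list \<Rightarrow> svl" where
  "svl_lincomb U as ts = foldr svl_add (map2 svl_smult as ts) (svl_zero U)"

definition svl_span :: "real mat \<Rightarrow> svl list \<Rightarrow> svl set" where
  "svl_span U ts =
     {t. is_svl U t \<and> (\<exists>as. length as = length ts \<and> svl_eq U t (svl_lincomb U as ts))}"

definition svl_lin_indpt :: "real mat \<Rightarrow> svl list \<Rightarrow> bool" where
  "svl_lin_indpt U ts \<longleftrightarrow>
     (\<forall>as. length as = length ts \<and> svl_eq U (svl_lincomb U as ts) (svl_zero U)
        \<longrightarrow> (\<forall>a \<in> set as. a = 0))"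

definition svl_orthonormal :: "svl list \<Rightarrow> bool" where
  "svl_orthonormal qs \<longleftrightarrow>
     (\<forall>i < length qs. \<forall>j < length qs. svl_inner (qs ! i) (qs ! j) = (if i = j then 1 else 0))"

definition svl_orthonormal_basis :: "real mat \<Rightarrow> svl list \<Rightarrow> svl list \<Rightarrow> bool" where
  "svl_orthonormal_basis U qs ts \<longleftrightarrow>
     (\<forall>q \<in> set qs. is_svl U q) \<and> svl_orthonormal qs \<and> svl_lin_indpt U qs
     \<and> svl_span U qs = svl_span U ts"

definition nnz :: "real vec \<Rightarrow> nat" where
  "nnz v = card {i. i < dim_vec v \<and> v $ i \<noteq> 0}"


section \<open>A real random-access machine\<close>

text \<open>
  Algorithms are programs of a while language over natural numbers (indices and counters) and
  reals, with unbounded one-dimensional arrays of both sorts. Every operator, variable access,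
  array access and test costs one unit. The language is kept weak on purpose: natural numbers
  have no multiplication, reals cannot be converted to natural numbers, and a program contains
  no real constants except natural-number literals.

  Division by zero and square roots of negative numbers take the values of HOL (\<open>x / 0 = 0\<close>,
  \<open>sqrt (- x) = - sqrt x\<close>). A program can test for these cases at constant cost, so this adds
  no computational power.
\<close>

datatype nexp =
    NLit nat
  | NVar string
  | NGet string nexp
  | NAdd nexp nexp
  | NSub nexp nexp

datatype rexp =
    RLit nat
  | RVar string
  | RGet string nexp
  | RAdd rexp rexp
  | RSub rexp rexp
  | RMul rexp rexp
  | RDiv rexp rexp
  | RSqrt rexp

datatype bexp =
    NLess nexp nexp
  | NEq nexp nexp
  | RLess rexp rexp
  | REq rexp rexp
  | BNot bexp
  | BAnd bexp bexp

datatype com =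
    Skip
  | NAssign string nexp
  | RAssign string rexp
  | NStore string nexp nexp
  | RStore string nexp rexp
  | Seq com com
  | Cond bexp com com
  | While bexp com

record state =
  nvar :: "string \<Rightarrow> nat"
  rvar :: "string \<Rightarrow> real"
  narr :: "string \<Rightarrow> nat \<Rightarrow> nat"
  rarr :: "string \<Rightarrow> nat \<Rightarrow> real"

primrec nval :: "nexp \<Rightarrow> state \<Rightarrow> nat" where
  "nval (NLit n) st = n"
| "nval (NVar x) st = nvar st x"
| "nval (NGet a e) st = narr st a (nval e st)"
| "nval (NAdd e f) st = nval e st + nval f st"
| "nval (NSub e f) st = nval e st - nval f st"

primrec ncost :: "nexp \<Rightarrow> nat" where
  "ncost (NLit n) = 1"
| "ncost (NVar x) = 1"
| "ncost (NGet a e) = 1 + ncost e"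
| "ncost (NAdd e f) = 1 + ncost e + ncost f"
| "ncost (NSub e f) = 1 + ncost e + ncost f"

primrec rval :: "rexp \<Rightarrow> state \<Rightarrow> real" where
  "rval (RLit n) st = real n"
| "rval (RVar x) st = rvar st x"
| "rval (RGet a e) st = rarr st a (nval e st)"
| "rval (RAdd e f) st = rval e st + rval f st"
| "rval (RSub e f) st = rval e st - rval f st"
| "rval (RMul e f) st = rval e st * rval f st"
| "rval (RDiv e f) st = rval e st / rval f st"
| "rval (RSqrt e) st = sqrt (rval e st)"

primrec rcost :: "rexp \<Rightarrow> nat" where
  "rcost (RLit n) = 1"
| "rcost (RVar x) = 1"
| "rcost (RGet a e) = 1 + ncost e"
| "rcost (RAdd e f) = 1 + rcost e + rcost f"
| "rcost (RSub e f) = 1 + rcost e + rcost f"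
| "rcost (RMul e f) = 1 + rcost e + rcost f"
| "rcost (RDiv e f) = 1 + rcost e + rcost f"
| "rcost (RSqrt e) = 1 + rcost e"

primrec bval :: "bexp \<Rightarrow> state \<Rightarrow> bool" where
  "bval (NLess e f) st = (nval e st < nval f st)"
| "bval (NEq e f) st = (nval e st = nval f st)"
| "bval (RLess e f) st = (rval e st < rval f st)"
| "bval (REq e f) st = (rval e st = rval f st)"
| "bval (BNot b) st = (\<not> bval b st)"
| "bval (BAnd b c) st = (bval b st \<and> bval c st)"

primrec bcost :: "bexp \<Rightarrow> nat" where
  "bcost (NLess e f) = 1 + ncost e + ncost f"
| "bcost (NEq e f) = 1 + ncost e + ncost f"
| "bcost (RLess e f) = 1 + rcost e + rcost f"
| "bcost (REq e f) = 1 + rcost e + rcost f"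
| "bcost (BNot b) = 1 + bcost b"
| "bcost (BAnd b c) = 1 + bcost b + bcost c"

text \<open>\<open>exec c st t st'\<close>: started in \<open>st\<close>, the program \<open>c\<close> halts in \<open>st'\<close> after \<open>t\<close> time units.\<close>

inductive exec :: "com \<Rightarrow> state \<Rightarrow> nat \<Rightarrow> state \<Rightarrow> bool" where
  Skip: "exec Skip st 1 st"
| NAssign: "exec (NAssign x e) st (1 + ncost e) (st\<lparr>nvar := (nvar st)(x := nval e st)\<rparr>)"
| RAssign: "exec (RAssign x e) st (1 + rcost e) (st\<lparr>rvar := (rvar st)(x := rval e st)\<rparr>)"
| NStore: "exec (NStore a i e) st (1 + ncost i + ncost e)
    (st\<lparr>narr := (narr st)(a := (narr st a)(nval i st := nval e st))\<rparr>)"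
| RStore: "exec (RStore a i e) st (1 + ncost i + rcost e)
    (st\<lparr>rarr := (rarr st)(a := (rarr st a)(nval i st := rval e st))\<rparr>)"
| Seq: "exec c st t st' \<Longrightarrow> exec d st' t' st'' \<Longrightarrow> exec (Seq c d) st (t + t') st''"
| CondTrue: "bval b st \<Longrightarrow> exec c st t st' \<Longrightarrow> exec (Cond b c d) st (1 + bcost b + t) st'"
| CondFalse: "\<not> bval b st \<Longrightarrow> exec d st t st' \<Longrightarrow> exec (Cond b c d) st (1 + bcost b + t) st'"
| WhileFalse: "\<not> bval b st \<Longrightarrow> exec (While b c) st (1 + bcost b) st"
| WhileTrue: "bval b st \<Longrightarrow> exec c st t st' \<Longrightarrow> exec (While b c) st' t' st''
    \<Longrightarrow> exec (While b c) st (1 + bcost b + t + t') st''"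

lemma exec_deterministic:
  assumes "exec c st t st'" "exec c st u st''"
  shows "u = t \<and> st'' = st'"
  using assms
proof (induction arbitrary: u st'' rule: exec.induct)
  case (Skip st)
  from Skip.prems show ?case by cases simp
next
  case (NAssign x e st)
  from NAssign.prems show ?case by cases simp
next
  case (RAssign x e st)
  from RAssign.prems show ?case by cases simp
next
  case (NStore a i e st)
  from NStore.prems show ?case by cases simp
next
  case (RStore a i e st)
  from RStore.prems show ?case by cases simp
next
  case (Seq c st t st1 d t' st2)
  from Seq.prems obtain t1 r t2 where "exec c st t1 r" "exec d r t2 st''" "u = t1 + t2"
    by cases
  with Seq.IH show ?case by metis
next
  case (CondTrue b st c t st1 d)
  from CondTrue.prems CondTrue.hyps obtain t1 where "exec c st t1 st''" "u = 1 + bcost b + t1"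
    by cases simp_all
  with CondTrue.IH show ?case by metis
next
  case (CondFalse b st d t st1 c)
  from CondFalse.prems CondFalse.hyps obtain t1 where "exec d st t1 st''" "u = 1 + bcost b + t1"
    by cases simp_all
  with CondFalse.IH show ?case by metis
next
  case (WhileFalse b st c)
  from WhileFalse.prems WhileFalse.hyps show ?case by cases simp_all
next
  case (WhileTrue b st c t st1 t' st2)
  from WhileTrue.prems WhileTrue.hyps obtain t1 r t2
    where "exec c st t1 r" "exec (While b c) r t2 st''" "u = 1 + bcost b + t1 + t2"
    by cases simp_all
  with WhileTrue.IH show ?case by metis
qed


section \<open>Storage of tuples\<close>

text \<open>
  The list \<open>(b\<^sub>0, c\<^sub>0), \<dots>, (b\<^sub>s\<^sub>-\<^sub>1, c\<^sub>s\<^sub>-\<^sub>1)\<close> is stored under the name prefix \<open>p\<close> as follows. The vectors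
  \<open>b\<^sub>i\<close> are in compressed sparse row form: the positions \<open>ptr i \<le> q < ptr (i + 1)\<close> of \<open>idx\<close> and
  \<open>val\<close> hold the indices and values of the nonzero entries of \<open>b\<^sub>i\<close>, each exactly once and in any
  order. The vectors \<open>c\<^sub>i\<close> are the rows of a dense row-major array \<open>coef\<close>. All other memory is
  unconstrained; in particular nothing is assumed to be initialised.
\<close>

definition svl_stored :: "string \<Rightarrow> nat \<Rightarrow> svl list \<Rightarrow> state \<Rightarrow> bool" where
  "svl_stored p k ts st \<longleftrightarrow>
     nvar st (p @ ''_len'') = length ts \<and>
     nvar st (p @ ''_k'') = k \<and>
     (\<forall>i \<le> length ts. narr st (p @ ''_ptr'') i = (\<Sum>j<i. nnz (fst (ts ! j)))) \<and>
     (\<forall>i < length ts.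
        let b = fst (ts ! i); c = snd (ts ! i);
            P = {narr st (p @ ''_ptr'') i ..< narr st (p @ ''_ptr'') (Suc i)}
        in bij_betw (narr st (p @ ''_idx'')) P {l. l < dim_vec b \<and> b $ l \<noteq> 0} \<and>
           (\<forall>q \<in> P. rarr st (p @ ''_val'') q = b $ narr st (p @ ''_idx'') q) \<and>
           (\<forall>j < k. rarr st (p @ ''_coef'') (i * k + j) = c $ j))"


end

theory Submission imports Defs begin

text \<open>
  For a tuple \<open>t = (b, U\<^sup>T b)\<close> let \<open>z = b - U U\<^sup>T b\<close> be the vector it represents. Because the columns
  of \<open>U\<close> are orthonormal, the tuple product \<open>\<langle>b, b'\<rangle> - \<langle>c, c'\<rangle>\<close> is the dot product \<open>\<langle>z, z'\<rangle>\<close>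
  (\<open>svl_inner_eq_scalar_prod\<close>). Tuples therefore form an inner product space up to the
  identification of tuples with the same \<open>z\<close>, and Gram-Schmidt can be carried out on the pairs
  \<open>(b, c)\<close> without ever touching \<open>U\<close>. An input whose residual has norm zero represents a vector
  in the span of its predecessors and is dropped. That the span is preserved is shown with an
  arbitrary subspace \<open>S\<close>: one step keeps the statement ``all vectors lie in \<open>S\<close>'' unchanged in both
  directions (\<open>gs_step_subset_iff\<close>), and taking the two spans for \<open>S\<close> gives both inclusions.

  For the running time, let \<open>N\<close> be the total number of stored nonzeros. Every vector met by the
  algorithm is a combination of inputs, so its sparse part is supported on at most \<open>N\<close> coordinates
  and the whole tuple fits into a dense row of length \<open>N + k\<close>. Inner products, subtractions and
  normalisations of rows then cost \<open>O(N + k)\<close>, and Gram-Schmidt performs \<open>O(s\<^sup>2)\<close> of them.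

  The remaining difficulty is to compress the coordinates without an array of size \<open>m\<close> that has
  been cleared, since memory is uninitialised and \<open>m\<close> does not enter the bound. The positions
  \<open>q < N\<close> of the input serve as slots. Storing \<open>q\<close> at address \<open>idx q\<close> of an array \<open>pos\<close>, for all \<open>q\<close>,
  leaves in \<open>pos\<close> one canonical slot for each coordinate that occurs, and no other address is
  ever read. A row has the entry of coordinate \<open>idx q\<close> at its canonical slot and \<open>0\<close> at the other slots of
  that coordinate (locale \<open>slots\<close>), so that sums over slots are sums over coordinates
  (\<open>signed_sum_rows\<close>) and the sparse form of a basis vector is read off its nonzero slots
  (\<open>bij_betw_support\<close>).

  The machine has no multiplication of indices. Row offsets are kept in variables that advance by
  one row length at a time.
\<close>

section \<open>Gram-Schmidt on tuples\<close>

text \<open>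
  In \<open>svl_reduce\<close> the coefficient is the product of \<open>q\<close> with the current residual instead of the
  original vector (modified Gram-Schmidt), so that a program can overwrite the residual in place.
\<close>

definition svl_reduce :: "svl \<Rightarrow> svl \<Rightarrow> svl" where
  "svl_reduce w q = svl_add w (svl_smult (- svl_inner q w) q)"

definition svl_normalize :: "svl \<Rightarrow> svl" where
  "svl_normalize w = svl_smult (1 / sqrt (svl_inner w w)) w"

definition gs_step :: "svl list \<Rightarrow> svl \<Rightarrow> svl list" where
  "gs_step qs t = (let w = foldl svl_reduce t qs
     in if svl_inner w w = 0 then qs else qs @ [svl_normalize w])"

definition gram_schmidt :: "svl list \<Rightarrow> svl list" where
  "gram_schmidt ts = foldl gs_step [] ts"

lemma length_gs_step: "length (gs_step qs t) \<le> Suc (length qs)"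
  by (simp add: gs_step_def Let_def)

lemma length_gram_schmidt: "length (gram_schmidt ts) \<le> length ts"
proof (induction ts rule: rev_induct)
  case (snoc t ts)
  then show ?case
    using length_gs_step[of "gram_schmidt ts" t] by (simp add: gram_schmidt_def)
qed (simp add: gram_schmidt_def)

locale orthonormal_columns =
  fixes U :: "real mat" and m k :: nat
  assumes U: "U \<in> carrier_mat m k" and UU: "transpose_mat U * U = 1\<^sub>m k"
begin

lemma is_svl_carrier:
  assumes "is_svl U t"
  shows "fst t \<in> carrier_vec m" "snd t \<in> carrier_vec k" "snd t = transpose_mat U *\<^sub>v fst t"
    "svl_vec U t \<in> carrier_vec m"
  using assms U by (auto simp: is_svl_def svl_vec_def)

lemma is_svl_add: "is_svl U t \<Longrightarrow> is_svl U t' \<Longrightarrow> is_svl U (svl_add t t')"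
  using U by (auto simp: is_svl_def svl_add_def mult_add_distrib_mat_vec)

lemma is_svl_smult: "is_svl U t \<Longrightarrow> is_svl U (svl_smult a t)"
  using U by (auto simp: is_svl_def svl_smult_def mult_mat_vec)

lemma is_svl_zero: "is_svl U (svl_zero U)"
proof -
  have "0\<^sub>v k = transpose_mat U *\<^sub>v 0\<^sub>v m"
    using U by (intro eq_vecI) (auto intro!: sum.neutral simp: scalar_prod_def)
  then show ?thesis using U by (auto simp: is_svl_def svl_zero_def)
qed

lemma svl_vec_add:
  "is_svl U t \<Longrightarrow> is_svl U t' \<Longrightarrow> svl_vec U (svl_add t t') = svl_vec U t + svl_vec U t'"
  using is_svl_carrier[of t] is_svl_carrier[of t'] U
  by (intro eq_vecI) (auto simp: svl_vec_def svl_add_def mult_add_distrib_mat_vec)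

lemma svl_vec_smult: "is_svl U t \<Longrightarrow> svl_vec U (svl_smult a t) = a \<cdot>\<^sub>v svl_vec U t"
  using is_svl_carrier[of t] U
  by (intro eq_vecI) (auto simp: svl_vec_def svl_smult_def mult_mat_vec algebra_simps)

lemma svl_vec_smult_0: "is_svl U t \<Longrightarrow> svl_vec U (svl_smult 0 t) = 0\<^sub>v m"
  using is_svl_carrier(4)[of t] by (auto simp: svl_vec_smult intro!: eq_vecI)

lemma svl_vec_zero: "svl_vec U (svl_zero U) = 0\<^sub>v m"
proof -
  have "U *\<^sub>v 0\<^sub>v k = 0\<^sub>v m"
    using U by (intro eq_vecI) (auto intro!: sum.neutral simp: scalar_prod_def)
  then show ?thesis using U by (auto simp: svl_vec_def svl_zero_def)
qed

text \<open>
  The two mixed terms \<open>\<langle>U c, b'\<rangle>\<close> and \<open>\<langle>b, U c'\<rangle>\<close> equal \<open>\<langle>c, c'\<rangle>\<close> by moving \<open>U\<close> to the other side, and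
  \<open>\<langle>U c, U c'\<rangle> = \<langle>c, c'\<rangle>\<close> since \<open>U\<^sup>T U = 1\<close>. One copy of \<open>\<langle>c, c'\<rangle>\<close> remains, with a minus sign.
\<close>

lemma svl_inner_eq_scalar_prod:
  assumes t: "is_svl U t" and t': "is_svl U t'"
  shows "svl_inner t t' = svl_vec U t \<bullet> svl_vec U t'"
proof -
  obtain b c b' c' where e: "t = (b, c)" "t' = (b', c')" by fastforce
  have car: "b \<in> carrier_vec m" "c \<in> carrier_vec k" "b' \<in> carrier_vec m" "c' \<in> carrier_vec k"
      "U *\<^sub>v c \<in> carrier_vec m" "U *\<^sub>v c' \<in> carrier_vec m"
    and c: "transpose_mat U *\<^sub>v b = c" "transpose_mat U *\<^sub>v b' = c'"
    using is_svl_carrier[OF t] is_svl_carrier[OF t'] e U by auto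
  have 1: "(U *\<^sub>v c) \<bullet> b' = c \<bullet> c'"
    using transpose_vec_mult_scalar[OF U car(2) car(3)] c comm_scalar_prod[OF car(2) car(4)]
      comm_scalar_prod[OF car(5) car(3)] by simp
  have "(U *\<^sub>v c') \<bullet> b = c' \<bullet> c"
    using transpose_vec_mult_scalar[OF U car(4) car(1)] c comm_scalar_prod[OF car(2) car(4)]
      comm_scalar_prod[OF car(6) car(1)] by simp
  then have 2: "b \<bullet> (U *\<^sub>v c') = c \<bullet> c'"
    using comm_scalar_prod[OF car(1) car(6)] comm_scalar_prod[OF car(2) car(4)] by simp
  have "transpose_mat U *\<^sub>v (U *\<^sub>v c') = (transpose_mat U * U) *\<^sub>v c'"
    using U car by simp
  then have "transpose_mat U *\<^sub>v (U *\<^sub>v c') = c'" using UU car by simp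
  then have 3: "(U *\<^sub>v c) \<bullet> (U *\<^sub>v c') = c \<bullet> c'"
    using transpose_vec_mult_scalar[OF U car(2) car(6)]
    using comm_scalar_prod[OF car(2) car(4)] comm_scalar_prod[OF car(5) car(6)] by simp
  have "(b - U *\<^sub>v c) \<bullet> (b' - U *\<^sub>v c')
      = b \<bullet> b' - b \<bullet> (U *\<^sub>v c') - ((U *\<^sub>v c) \<bullet> b' - (U *\<^sub>v c) \<bullet> (U *\<^sub>v c'))"
    using car by (simp add: minus_scalar_prod_distrib[where n=m] scalar_prod_minus_distrib[where n=m])
  with 1 2 3 show ?thesis by (simp add: e svl_inner_def svl_vec_def)
qed

lemma svl_inner_commute: "is_svl U t \<Longrightarrow> is_svl U t' \<Longrightarrow> svl_inner t t' = svl_inner t' t"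
  using is_svl_carrier[of t] is_svl_carrier[of t']
  by (simp add: svl_inner_def comm_scalar_prod)

lemma svl_inner_add:
  "is_svl U q \<Longrightarrow> is_svl U t \<Longrightarrow> is_svl U t' \<Longrightarrow>
    svl_inner q (svl_add t t') = svl_inner q t + svl_inner q t'"
  using is_svl_carrier[of q] is_svl_carrier[of t] is_svl_carrier[of t']
  by (simp add: svl_inner_def svl_add_def scalar_prod_add_distrib)

lemma svl_inner_smult:
  "is_svl U q \<Longrightarrow> is_svl U t \<Longrightarrow> svl_inner q (svl_smult a t) = a * svl_inner q t"
  using is_svl_carrier[of q] is_svl_carrier[of t]
  by (simp add: svl_inner_def svl_smult_def algebra_simps)

lemma svl_inner_zero: "is_svl U q \<Longrightarrow> svl_inner q (svl_zero U) = 0"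
  using is_svl_carrier[of q] U by (auto simp: svl_inner_def svl_zero_def)

lemma svl_inner_self_nonneg: "is_svl U t \<Longrightarrow> 0 \<le> svl_inner t t"
  by (auto simp: svl_inner_eq_scalar_prod scalar_prod_def intro!: sum_nonneg)

lemma svl_inner_self_eq_0:
  assumes "is_svl U t" "svl_inner t t = 0"
  shows "svl_vec U t = 0\<^sub>v m"
proof -
  have "(\<Sum>i\<in>{0..<m}. svl_vec U t $ i * svl_vec U t $ i) = 0"
    using assms is_svl_carrier[OF assms(1)] by (auto simp: svl_inner_eq_scalar_prod scalar_prod_def)
  then have "\<forall>i\<in>{0..<m}. svl_vec U t $ i * svl_vec U t $ i = 0"
    by (subst (asm) sum_nonneg_eq_0_iff) auto
  then show ?thesis using is_svl_carrier[OF assms(1)] by (intro eq_vecI) auto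
qed

subsection \<open>Spans\<close>

text \<open>
  Subspaces of the quotient in which tuples with the same vector are identified, given as sets of
  tuples: all tuples for the zero vector are members, which makes such sets closed under the
  identification of valid tuples (\<open>svl_subspace_cong\<close>).
\<close>

definition svl_subspace :: "svl set \<Rightarrow> bool" where
  "svl_subspace S \<longleftrightarrow>
     (\<forall>t. is_svl U t \<and> svl_vec U t = 0\<^sub>v m \<longrightarrow> t \<in> S) \<and>
     (\<forall>t \<in> S. \<forall>t' \<in> S. svl_add t t' \<in> S) \<and> (\<forall>a. \<forall>t \<in> S. svl_smult a t \<in> S)"

lemma svl_subspace_null: "svl_subspace S \<Longrightarrow> is_svl U t \<Longrightarrow> svl_vec U t = 0\<^sub>v m \<Longrightarrow> t \<in> S"
  and svl_subspace_add: "svl_subspace S \<Longrightarrow> t \<in> S \<Longrightarrow> t' \<in> S \<Longrightarrow> svl_add t t' \<in> S"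
  and svl_subspace_smult: "svl_subspace S \<Longrightarrow> t \<in> S \<Longrightarrow> svl_smult a t \<in> S"
  unfolding svl_subspace_def by blast+

lemma svl_add_add_smult_cancel:
  assumes "is_svl U t" "is_svl U t'"
  shows "svl_add (svl_add t (svl_smult (- a) t')) (svl_smult a t') = t"
    and "svl_add t (svl_add t' (svl_smult (- 1) t)) = t'"
  using is_svl_carrier[OF assms(1)] is_svl_carrier[OF assms(2)]
  by (auto simp: svl_add_def svl_smult_def intro!: prod_eqI eq_vecI)

lemma svl_subspace_cong:
  assumes S: "svl_subspace S" and t: "is_svl U t" "is_svl U t'" "svl_eq U t' t" and "t \<in> S"
  shows "t' \<in> S"
proof -
  have "svl_vec U (svl_add t' (svl_smult (- 1) t)) = 0\<^sub>v m"
    using t is_svl_carrier[OF t(1)] is_svl_carrier[OF t(2)]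
    by (auto simp: svl_vec_add svl_vec_smult is_svl_smult svl_eq_def intro!: eq_vecI)
  then have "svl_add t' (svl_smult (- 1) t) \<in> S"
    using svl_subspace_null[OF S] t is_svl_add is_svl_smult by blast
  then show ?thesis
    using svl_subspace_add[OF S \<open>t \<in> S\<close>] svl_add_add_smult_cancel(2)[OF t(1,2)] by metis
qed

lemma lincomb_Nil [simp]: "svl_lincomb U as [] = svl_zero U" "svl_lincomb U [] ts = svl_zero U"
  and lincomb_Cons [simp]:
    "svl_lincomb U (a # as) (t # ts) = svl_add (svl_smult a t) (svl_lincomb U as ts)"
  by (auto simp: svl_lincomb_def)

lemma is_svl_lincomb:
  "length as = length ts \<Longrightarrow> \<forall>t \<in> set ts. is_svl U t \<Longrightarrow> is_svl U (svl_lincomb U as ts)"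
  by (induction as ts rule: list_induct2) (auto intro: is_svl_zero is_svl_add is_svl_smult)

lemma lincomb_add:
  "length as = length ts \<Longrightarrow> length bs = length ts \<Longrightarrow> \<forall>t \<in> set ts. is_svl U t \<Longrightarrow>
    svl_lincomb U (map2 (+) as bs) ts = svl_add (svl_lincomb U as ts) (svl_lincomb U bs ts)"
proof (induction ts arbitrary: as bs)
  case Nil
  then show ?case using U by (auto simp: svl_add_def svl_zero_def)
next
  case (Cons t ts)
  obtain a as' b bs' where e: "as = a # as'" "bs = b # bs'"
    using Cons.prems by (metis length_Suc_conv length_Cons)
  have l: "length as' = length ts" "length bs' = length ts" and ts: "\<forall>t \<in> set ts. is_svl U t"
    using Cons.prems e by auto
  show ?case
    using Cons.IH[OF l ts] is_svl_carrier[of t] Cons.prems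
      is_svl_carrier[OF is_svl_lincomb[OF l(1) ts]] is_svl_carrier[OF is_svl_lincomb[OF l(2) ts]]
    by (auto simp: e svl_add_def svl_smult_def algebra_simps intro!: eq_vecI)
qed

lemma lincomb_smult:
  "length as = length ts \<Longrightarrow> \<forall>t \<in> set ts. is_svl U t \<Longrightarrow>
    svl_lincomb U (map ((*) a) as) ts = svl_smult a (svl_lincomb U as ts)"
proof (induction as ts rule: list_induct2)
  case Nil
  then show ?case by (auto simp: svl_smult_def svl_zero_def)
next
  case (Cons b as t ts)
  then have ts: "\<forall>t \<in> set ts. is_svl U t" by auto
  show ?case
    using Cons.IH[OF ts] is_svl_carrier[of t] Cons.prems
      is_svl_carrier[OF is_svl_lincomb[OF Cons.hyps ts]]
    by (auto simp: svl_add_def svl_smult_def algebra_simps intro!: eq_vecI)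
qed

lemma svl_subspace_span:
  assumes ts: "\<forall>t \<in> set ts. is_svl U t"
  shows "svl_subspace (svl_span U ts)"
  unfolding svl_subspace_def
proof (intro conjI allI impI ballI)
  fix t assume t: "is_svl U t \<and> svl_vec U t = 0\<^sub>v m"
  let ?z = "replicate (length ts) 0"
  have l: "is_svl U (svl_lincomb U ?z ts)" using ts by (simp add: is_svl_lincomb)
  have "svl_vec U (svl_lincomb U (map ((*) 0) ?z) ts) = 0\<^sub>v m"
    using ts l by (subst lincomb_smult) (simp_all add: svl_vec_smult_0)
  with t show "t \<in> svl_span U ts"
    by (auto simp: svl_span_def svl_eq_def intro!: exI[of _ "map ((*) 0) ?z"])
next
  fix t t' assume "t \<in> svl_span U ts" "t' \<in> svl_span U ts"
  then obtain as bs where t: "is_svl U t" "length as = length ts" "svl_eq U t (svl_lincomb U as ts)"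
    and t': "is_svl U t'" "length bs = length ts" "svl_eq U t' (svl_lincomb U bs ts)"
    by (auto simp: svl_span_def)
  have "svl_eq U (svl_add t t') (svl_lincomb U (map2 (+) as bs) ts)"
    using t t' ts by (simp add: svl_eq_def svl_vec_add lincomb_add is_svl_lincomb)
  then show "svl_add t t' \<in> svl_span U ts"
    using t t' is_svl_add by (auto simp: svl_span_def intro!: exI[of _ "map2 (+) as bs"])
next
  fix a t assume "t \<in> svl_span U ts"
  then obtain as where t: "is_svl U t" "length as = length ts" "svl_eq U t (svl_lincomb U as ts)"
    by (auto simp: svl_span_def)
  have "svl_eq U (svl_smult a t) (svl_lincomb U (map ((*) a) as) ts)"
    using t ts by (simp add: svl_eq_def svl_vec_smult lincomb_smult is_svl_lincomb)
  then show "svl_smult a t \<in> svl_span U ts"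
    using t is_svl_smult by (auto simp: svl_span_def intro!: exI[of _ "map ((*) a) as"])
qed

lemma svl_vec_add_null:
  "is_svl U t \<Longrightarrow> is_svl U z \<Longrightarrow> svl_vec U z = 0\<^sub>v m \<Longrightarrow> svl_vec U (svl_add t z) = svl_vec U t"
  using is_svl_carrier[of t] by (simp add: svl_vec_add)

text \<open>
  The coefficient lists are built along the list: \<open>1\<close> followed by coefficients of the zero tuple for
  the head, and \<open>0\<close> followed by known coefficients for a member of the tail.
\<close>

lemma set_subset_span:
  "\<forall>t \<in> set ts. is_svl U t \<Longrightarrow> set ts \<subseteq> svl_span U ts"
proof (induction ts)
  case (Cons t ts)
  have car: "is_svl U t" "\<forall>t \<in> set ts. is_svl U t" using Cons.prems by auto
  have "svl_zero U \<in> svl_span U ts"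
    by (rule svl_subspace_null[OF svl_subspace_span[OF car(2)] is_svl_zero svl_vec_zero])
  then obtain zs where zs: "length zs = length ts" "svl_eq U (svl_zero U) (svl_lincomb U zs ts)"
    by (auto simp: svl_span_def)
  have "svl_vec U (svl_lincomb U (1 # zs) (t # ts)) = svl_vec U (svl_smult 1 t)"
    using zs car is_svl_lincomb[OF zs(1) car(2)]
    by (simp add: svl_vec_add_null is_svl_smult svl_eq_def svl_vec_zero)
  also have "svl_smult 1 t = t" by (simp add: svl_smult_def)
  finally have t: "t \<in> svl_span U (t # ts)"
    using zs car by (auto simp: svl_span_def svl_eq_def intro!: exI[of _ "1 # zs"])
  have "t' \<in> svl_span U (t # ts)" if mem: "t' \<in> set ts" for t'
  proof -
    from Cons.IH[OF car(2)] mem have "t' \<in> svl_span U ts" by blast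
    then obtain as where as: "length as = length ts" "svl_eq U t' (svl_lincomb U as ts)"
      by (auto simp: svl_span_def)
    have l: "is_svl U (svl_lincomb U as ts)" by (rule is_svl_lincomb[OF as(1) car(2)])
    have "svl_vec U (svl_lincomb U (0 # as) (t # ts)) = svl_vec U (svl_lincomb U as ts)"
      using l car is_svl_carrier[OF l] is_svl_carrier[OF car(1)]
      by (auto simp: svl_vec_add svl_vec_smult is_svl_smult intro!: eq_vecI)
    then show ?thesis
      using as car mem by (auto simp: svl_span_def svl_eq_def intro!: exI[of _ "0 # as"])
  qed
  with t show ?case by auto
qed simp

lemma lincomb_in_subspace:
  assumes "svl_subspace S"
  shows "length as = length ts \<Longrightarrow> set ts \<subseteq> S \<Longrightarrow> svl_lincomb U as ts \<in> S"
proof (induction as ts rule: list_induct2)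
  case Nil
  then show ?case using svl_subspace_null[OF assms is_svl_zero svl_vec_zero] by simp
next
  case (Cons a as t ts)
  then show ?case using svl_subspace_add[OF assms] svl_subspace_smult[OF assms] by simp
qed

lemma span_least:
  assumes S: "svl_subspace S" and ts: "\<forall>t \<in> set ts. is_svl U t" "set ts \<subseteq> S"
  shows "svl_span U ts \<subseteq> S"
proof
  fix t assume "t \<in> svl_span U ts"
  then obtain as where t: "is_svl U t" "length as = length ts" "svl_eq U t (svl_lincomb U as ts)"
    by (auto simp: svl_span_def)
  with svl_subspace_cong[OF S is_svl_lincomb[OF t(2) ts(1)]] lincomb_in_subspace[OF S t(2) ts(2)]
  show "t \<in> S" by auto
qed

subsection \<open>Correctness\<close>

lemma is_svl_reduce: "is_svl U w \<Longrightarrow> is_svl U q \<Longrightarrow> is_svl U (svl_reduce w q)"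
  by (simp add: svl_reduce_def is_svl_add is_svl_smult)

lemma is_svl_residual:
  "is_svl U w \<Longrightarrow> \<forall>q \<in> set qs. is_svl U q \<Longrightarrow> is_svl U (foldl svl_reduce w qs)"
  by (induction qs arbitrary: w) (simp_all add: is_svl_reduce)

lemma is_svl_normalize: "is_svl U w \<Longrightarrow> is_svl U (svl_normalize w)"
  by (simp add: svl_normalize_def is_svl_smult)

text \<open>
  Subtracting a multiple of a member of \<open>S\<close> is undone by adding it again.
\<close>

lemma reduce_mem_iff:
  assumes "svl_subspace S" "is_svl U w" "is_svl U q" "q \<in> S"
  shows "svl_reduce w q \<in> S \<longleftrightarrow> w \<in> S"
proof
  assume "svl_reduce w q \<in> S"
  then have "svl_add (svl_reduce w q) (svl_smult (svl_inner q w) q) \<in> S"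
    using assms by (intro svl_subspace_add svl_subspace_smult) auto
  then show "w \<in> S"
    using svl_add_add_smult_cancel(1)[OF assms(2,3)] by (simp add: svl_reduce_def)
next
  assume "w \<in> S"
  then show "svl_reduce w q \<in> S"
    using assms unfolding svl_reduce_def by (intro svl_subspace_add svl_subspace_smult) auto
qed

lemma residual_mem_iff:
  assumes "svl_subspace S"
  shows "is_svl U w \<Longrightarrow> \<forall>q \<in> set qs. is_svl U q \<Longrightarrow> set qs \<subseteq> S \<Longrightarrow>
    foldl svl_reduce w qs \<in> S \<longleftrightarrow> w \<in> S"
  by (induction qs arbitrary: w) (auto simp: is_svl_reduce reduce_mem_iff[OF assms])

lemma normalize_mem_iff:
  assumes S: "svl_subspace S" and w: "is_svl U w" "svl_inner w w \<noteq> 0"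
  shows "svl_normalize w \<in> S \<longleftrightarrow> w \<in> S"
proof
  assume "svl_normalize w \<in> S"
  then have "svl_smult (sqrt (svl_inner w w)) (svl_normalize w) \<in> S"
    by (rule svl_subspace_smult[OF S])
  also have "svl_smult (sqrt (svl_inner w w)) (svl_normalize w) = w"
    using w by (simp add: svl_smult_def svl_normalize_def smult_smult_assoc)
  finally show "w \<in> S" .
qed (auto simp: svl_normalize_def intro: svl_subspace_smult[OF S])

text \<open>
  Reducing by members of \<open>S\<close> and scaling by a nonzero number do not affect membership in \<open>S\<close>, and a
  residual of norm zero represents the zero vector, which every subspace contains.
\<close>

lemma gs_step_subset_iff:
  assumes S: "svl_subspace S" and t: "is_svl U t" and qs: "\<forall>q \<in> set qs. is_svl U q"
  shows "set (gs_step qs t) \<subseteq> S \<longleftrightarrow> set qs \<subseteq> S \<and> t \<in> S"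
proof (cases "set qs \<subseteq> S")
  case True
  let ?w = "foldl svl_reduce t qs"
  have w: "is_svl U ?w" using t qs by (rule is_svl_residual)
  have iff: "?w \<in> S \<longleftrightarrow> t \<in> S" using True by (intro residual_mem_iff[OF S t qs])
  show ?thesis
  proof (cases "svl_inner ?w ?w = 0")
    case True
    then have "?w \<in> S" using svl_subspace_null[OF S w] svl_inner_self_eq_0[OF w] by blast
    with True iff show ?thesis by (simp add: gs_step_def)
  next
    case False
    with True iff normalize_mem_iff[OF S w] show ?thesis by (simp add: gs_step_def Let_def)
  qed
qed (auto simp: gs_step_def Let_def split: if_splits)

lemma svl_inner_reduce:
  assumes "is_svl U q" "is_svl U w" "is_svl U p"
  shows "svl_inner q (svl_reduce w p) = svl_inner q w - svl_inner p w * svl_inner q p"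
  using assms by (simp add: svl_reduce_def svl_inner_add svl_inner_smult is_svl_smult)

lemma svl_orthonormal_snoc:
  "svl_orthonormal (qs @ [p]) \<longleftrightarrow> svl_orthonormal qs \<and> svl_inner p p = 1
     \<and> (\<forall>q \<in> set qs. svl_inner q p = 0 \<and> svl_inner p q = 0)"
proof -
  let ?n = "length qs"
  have "svl_orthonormal (qs @ [p]) \<longleftrightarrow>
      (\<forall>i < ?n. (\<forall>j < ?n. svl_inner (qs ! i) (qs ! j) = (if i = j then 1 else 0))
         \<and> svl_inner (qs ! i) p = 0) \<and> (\<forall>j < ?n. svl_inner p (qs ! j) = 0) \<and> svl_inner p p = 1"
    by (simp add: svl_orthonormal_def All_less_Suc nth_append cong: conj_cong) blast
  then show ?thesis by (auto simp: svl_orthonormal_def all_set_conv_all_nth)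
qed

text \<open>
  Reducing by the last vector \<open>p\<close> makes the residual orthogonal to \<open>p\<close>. It does not disturb the
  orthogonality to the earlier vectors because these are orthogonal to \<open>p\<close>.
\<close>

lemma residual_orthogonal:
  "is_svl U w \<Longrightarrow> \<forall>q \<in> set qs. is_svl U q \<Longrightarrow> svl_orthonormal qs \<Longrightarrow>
    \<forall>q \<in> set qs. svl_inner q (foldl svl_reduce w qs) = 0"
proof (induction qs rule: rev_induct)
  case (snoc p qs)
  let ?v = "foldl svl_reduce w qs"
  have car: "is_svl U p" "\<forall>q \<in> set qs. is_svl U q" "is_svl U ?v"
    using snoc.prems by (auto intro: is_svl_residual)
  show ?case
    using snoc.IH[OF snoc.prems(1)] snoc.prems car
    by (auto simp: svl_orthonormal_snoc svl_inner_reduce)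
qed simp

lemma gs_step_correct:
  assumes t: "is_svl U t" and qs: "\<forall>q \<in> set qs. is_svl U q" "svl_orthonormal qs"
  shows "\<forall>q \<in> set (gs_step qs t). is_svl U q" "svl_orthonormal (gs_step qs t)"
proof -
  let ?w = "foldl svl_reduce t qs"
  have w: "is_svl U ?w" using t qs(1) by (rule is_svl_residual)
  show "\<forall>q \<in> set (gs_step qs t). is_svl U q"
    using qs is_svl_normalize[OF w] by (auto simp: gs_step_def Let_def)
  show "svl_orthonormal (gs_step qs t)"
  proof (cases "svl_inner ?w ?w = 0")
    case False
    let ?c = "1 / sqrt (svl_inner ?w ?w)"
    have n: "is_svl U (svl_normalize ?w)" by (rule is_svl_normalize[OF w])
    have "svl_inner q (svl_normalize ?w) = 0" if "q \<in> set qs" for q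
      using residual_orthogonal[OF t qs] that qs(1) w
      by (simp add: svl_normalize_def svl_inner_smult)
    moreover have "svl_inner (svl_normalize ?w) (svl_normalize ?w) = ?c * (?c * svl_inner ?w ?w)"
      using svl_inner_commute[OF is_svl_smult[OF w] w] w is_svl_smult[OF w]
      by (simp add: svl_normalize_def svl_inner_smult)
    moreover have "\<dots> = 1"
      using False svl_inner_self_nonneg[OF w] by (simp add: field_simps)
    ultimately show ?thesis
      using False qs svl_inner_commute n by (simp add: gs_step_def Let_def svl_orthonormal_snoc)
  qed (use qs in \<open>simp add: gs_step_def Let_def\<close>)
qed

lemma gram_schmidt_invariants:
  "\<forall>t \<in> set ts. is_svl U t \<Longrightarrow>
    (\<forall>q \<in> set (gram_schmidt ts). is_svl U q) \<and> svl_orthonormal (gram_schmidt ts) \<and>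
    (\<forall>S. svl_subspace S \<longrightarrow> (set (gram_schmidt ts) \<subseteq> S \<longleftrightarrow> set ts \<subseteq> S))"
proof (induction ts rule: rev_induct)
  case Nil
  then show ?case by (simp add: gram_schmidt_def svl_orthonormal_def)
next
  case (snoc t ts)
  have e: "gram_schmidt (ts @ [t]) = gs_step (gram_schmidt ts) t" by (simp add: gram_schmidt_def)
  have t: "is_svl U t" and ts: "\<forall>t \<in> set ts. is_svl U t" using snoc.prems by auto
  note IH = snoc.IH[OF ts]
  have qs: "\<forall>q \<in> set (gram_schmidt ts). is_svl U q" "svl_orthonormal (gram_schmidt ts)"
    using IH by auto
  have "set (gs_step (gram_schmidt ts) t) \<subseteq> S \<longleftrightarrow> set (ts @ [t]) \<subseteq> S" if S: "svl_subspace S" for S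
    using IH S by (simp add: gs_step_subset_iff[OF S t qs(1)] conj_commute)
  then show ?case unfolding e using gs_step_correct[OF t qs] by blast
qed

lemma inner_lincomb:
  "length as = length qs \<Longrightarrow> \<forall>q \<in> set qs. is_svl U q \<Longrightarrow> is_svl U p \<Longrightarrow>
    svl_inner p (svl_lincomb U as qs) = (\<Sum>i<length qs. as ! i * svl_inner p (qs ! i))"
proof (induction as qs rule: list_induct2)
  case Nil
  then show ?case by (simp add: svl_inner_zero)
next
  case (Cons a as q qs)
  then show ?case
    by (simp add: svl_inner_add svl_inner_smult is_svl_smult is_svl_lincomb
        sum.lessThan_Suc_shift del: sum.lessThan_Suc)
qed

text \<open>
  The product of a linear combination with the \<open>i\<close>-th vector is its \<open>i\<close>-th coefficient.
\<close>

lemma orthonormal_lin_indpt: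
  assumes qs: "\<forall>q \<in> set qs. is_svl U q" "svl_orthonormal qs"
  shows "svl_lin_indpt U qs"
  unfolding svl_lin_indpt_def
proof (intro allI impI ballI)
  fix as a assume as: "length as = length qs \<and> svl_eq U (svl_lincomb U as qs) (svl_zero U)"
    and "a \<in> set as"
  then obtain i where i: "i < length qs" "a = as ! i" by (auto simp: in_set_conv_nth)
  have "qs ! i \<in> set qs" using i by simp
  then have p: "is_svl U (qs ! i)" using qs by blast
  have l: "is_svl U (svl_lincomb U as qs)" using as qs by (intro is_svl_lincomb) auto
  have "svl_inner (qs ! i) (svl_lincomb U as qs) = svl_inner (qs ! i) (svl_zero U)"
    using as by (simp add: svl_inner_eq_scalar_prod[OF p l] svl_inner_eq_scalar_prod[OF p is_svl_zero] svl_eq_def)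
  also have "\<dots> = 0" by (rule svl_inner_zero[OF p])
  finally have "0 = (\<Sum>j<length qs. as ! j * svl_inner (qs ! i) (qs ! j))"
    using inner_lincomb[OF _ qs(1) p] as by simp
  also have "\<dots> = (\<Sum>j<length qs. if i = j then as ! j else 0)"
    using qs(2) i by (intro sum.cong) (auto simp: svl_orthonormal_def)
  also have "\<dots> = a" using i by (simp add: sum.delta')
  finally show "a = 0" by simp
qed

text \<open>
  A subspace contains the output exactly if it contains the input. Applied to the span of either
  list, this yields one of the two inclusions between the spans.
\<close>

theorem gram_schmidt_orthonormal_basis:
  assumes ts: "\<forall>t \<in> set ts. is_svl U t"
  shows "svl_orthonormal_basis U (gram_schmidt ts) ts"
proof -
  let ?qs = "gram_schmidt ts"
  have qs: "\<forall>q \<in> set ?qs. is_svl U q" "svl_orthonormal ?qs"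
    and iff: "\<And>S. svl_subspace S \<Longrightarrow> set ?qs \<subseteq> S \<longleftrightarrow> set ts \<subseteq> S"
    using gram_schmidt_invariants[OF ts] by auto
  have "svl_span U ?qs \<subseteq> svl_span U ts"
    using span_least[OF svl_subspace_span[OF ts] qs(1)] iff[OF svl_subspace_span[OF ts]]
      set_subset_span[OF ts] by blast
  moreover have "svl_span U ts \<subseteq> svl_span U ?qs"
    using span_least[OF svl_subspace_span[OF qs(1)] ts] iff[OF svl_subspace_span[OF qs(1)]]
      set_subset_span[OF qs(1)] by blast
  ultimately show ?thesis
    using qs orthonormal_lin_indpt[OF qs] by (auto simp: svl_orthonormal_basis_def)
qed

end

section \<open>Dense rows\<close>

text \<open>
  The contents of slot \<open>q\<close> belong to coordinate \<open>idx q\<close>, and \<open>pos l\<close> is the canonical slot of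
  coordinate \<open>l\<close>. The assumptions constrain \<open>pos\<close> only at coordinates that have a slot: elsewhere
  the array holds arbitrary data.
\<close>

locale slots =
  fixes m k N :: nat and idx pos :: "nat \<Rightarrow> nat"
  assumes idx_less: "q < N \<Longrightarrow> idx q < m"
    and pos_less: "q < N \<Longrightarrow> pos (idx q) < N"
    and idx_pos: "q < N \<Longrightarrow> idx (pos (idx q)) = idx q"
begin

text \<open>
  The dense row of a tuple: the sparse part in the first \<open>N\<close> places, with zeros at the slots that are
  not canonical, and then the coefficients \<open>c\<close>.
\<close>

definition slot_row :: "svl \<Rightarrow> nat \<Rightarrow> real" where
  "slot_row t x = (if x < N then if pos (idx x) = x then fst t $ idx x else 0 else snd t $ (x - N))"

text \<open>
  A row determines its tuple only if every nonzero coordinate has a slot.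
\<close>

definition covered :: "svl \<Rightarrow> bool" where
  "covered t \<longleftrightarrow> fst t \<in> carrier_vec m \<and> snd t \<in> carrier_vec k \<and>
     (\<forall>l < m. fst t $ l \<noteq> 0 \<longrightarrow> l \<in> idx ` {..<N})"

lemma covered_add: "covered t \<Longrightarrow> covered t' \<Longrightarrow> covered (svl_add t t')"
  by (auto simp: covered_def svl_add_def)

lemma covered_smult: "covered t \<Longrightarrow> covered (svl_smult a t)"
  by (auto simp: covered_def svl_smult_def)

lemma covered_reduce: "covered w \<Longrightarrow> covered q \<Longrightarrow> covered (svl_reduce w q)"
  by (simp add: svl_reduce_def covered_add covered_smult)

lemma covered_residual: "covered w \<Longrightarrow> \<forall>q \<in> set qs. covered q \<Longrightarrow> covered (foldl svl_reduce w qs)"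
  by (induction qs arbitrary: w) (simp_all add: covered_reduce)

lemma covered_normalize: "covered w \<Longrightarrow> covered (svl_normalize w)"
  by (simp add: svl_normalize_def covered_smult)

lemma covered_gs_step:
  "covered t \<Longrightarrow> \<forall>q \<in> set qs. covered q \<Longrightarrow> \<forall>q \<in> set (gs_step qs t). covered q"
  using covered_residual[of t qs] covered_normalize by (auto simp: gs_step_def Let_def)

lemma covered_gram_schmidt:
  "\<forall>t \<in> set ts. covered t \<Longrightarrow> \<forall>q \<in> set (gram_schmidt ts). covered q"
proof (induction ts rule: rev_induct)
  case (snoc t ts)
  then have "covered t" "\<forall>q \<in> set (gram_schmidt ts). covered q" by auto
  from covered_gs_step[OF this] show ?case by (simp add: gram_schmidt_def)
qed (simp add: gram_schmidt_def)

lemma slot_row_reduce: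
  assumes "covered w" "covered q" "x < N + k"
  shows "slot_row (svl_reduce w q) x = slot_row w x - svl_inner q w * slot_row q x"
  using assms idx_less[of x]
  by (auto simp: slot_row_def covered_def svl_reduce_def svl_add_def svl_smult_def)

lemma slot_row_normalize:
  assumes "covered w" "x < N + k"
  shows "slot_row (svl_normalize w) x = slot_row w x / sqrt (svl_inner w w)"
  using assms idx_less[of x]
  by (auto simp: slot_row_def covered_def svl_normalize_def svl_smult_def)

text \<open>
  \<open>pos\<close> inverts \<open>idx\<close> on the canonical slots, and \<open>pos (idx q)\<close> is a canonical slot with the same
  coordinate as \<open>q\<close>.
\<close>

lemma bij_betw_canonical: "bij_betw idx {x. x < N \<and> pos (idx x) = x} (idx ` {..<N})"
  unfolding bij_betw_def
proof
  show "inj_on idx {x. x < N \<and> pos (idx x) = x}" by (rule inj_on_inverseI[where g = pos]) simp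
  show "idx ` {x. x < N \<and> pos (idx x) = x} = idx ` {..<N}"
  proof (intro subset_antisym subsetI)
    fix l assume "l \<in> idx ` {..<N}"
    then obtain q where "q < N" "l = idx q" by auto
    then have "l = idx (pos (idx q))" "pos (idx q) < N" "pos (idx (pos (idx q))) = pos (idx q)"
      using idx_pos pos_less by auto
    then show "l \<in> idx ` {x. x < N \<and> pos (idx x) = x}" by blast
  qed auto
qed

text \<open>
  Slots that are not canonical contribute \<open>0\<close>, and the canonical ones enumerate the coordinates without
  repetition. The minus sign of the tuple product is attached to the places of the coefficients
  \<open>c\<close>, so that one loop over a row computes the whole product.
\<close>

lemma signed_sum_rows:
  assumes t: "covered t" and t': "covered t'"
  shows "(\<Sum>x<N + k. if x < N then slot_row t x * slot_row t' x else - (slot_row t x * slot_row t' x)) = svl_inner t t'"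
proof -
  let ?g = "\<lambda>l. fst t $ l * fst t' $ l"
  have "(\<Sum>x<N. slot_row t x * slot_row t' x) = (\<Sum>x \<in> {x. x < N \<and> pos (idx x) = x}. ?g (idx x))"
    by (rule sum.mono_neutral_cong_right) (auto simp: slot_row_def)
  also have "\<dots> = (\<Sum>l \<in> idx ` {..<N}. ?g l)"
    by (rule sum.reindex_bij_betw[OF bij_betw_canonical])
  also have "\<dots> = (\<Sum>l = 0..<m. ?g l)"
    using t idx_less by (intro sum.mono_neutral_left) (auto simp: covered_def)
  finally have b: "(\<Sum>x<N. slot_row t x * slot_row t' x) = fst t \<bullet> fst t'"
    using t' by (auto simp: scalar_prod_def covered_def)
  have "(\<Sum>x<k. - (slot_row t (N + x) * slot_row t' (N + x))) = - (snd t \<bullet> snd t')"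
    using t' by (auto simp: scalar_prod_def covered_def slot_row_def sum_negf atLeast0LessThan)
  moreover have "(\<Sum>x<N + k. f x) = (\<Sum>x<N. f x) + (\<Sum>x<k. f (N + x))" for f :: "nat \<Rightarrow> real"
    by (induction k) auto
  ultimately show ?thesis using b by (simp add: svl_inner_def)
qed

text \<open>
  This is what allows a sparse vector to be emitted by a scan through the slots: every nonzero
  coordinate is met exactly once.
\<close>

lemma bij_betw_support:
  assumes "covered t"
  shows "bij_betw idx {x. x < N \<and> slot_row t x \<noteq> 0} {l. l < dim_vec (fst t) \<and> fst t $ l \<noteq> 0}"
proof (rule bij_betw_subset[OF bij_betw_canonical])
  show "{x. x < N \<and> slot_row t x \<noteq> 0} \<subseteq> {x. x < N \<and> pos (idx x) = x}" by (auto simp: slot_row_def)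
  show "idx ` {x. x < N \<and> slot_row t x \<noteq> 0} = {l. l < dim_vec (fst t) \<and> fst t $ l \<noteq> 0}"
  proof (intro subset_antisym subsetI)
    fix l assume "l \<in> idx ` {x. x < N \<and> slot_row t x \<noteq> 0}"
    then show "l \<in> {l. l < dim_vec (fst t) \<and> fst t $ l \<noteq> 0}"
      using assms idx_less by (auto simp: covered_def slot_row_def split: if_splits)
  next
    fix l assume l: "l \<in> {l. l < dim_vec (fst t) \<and> fst t $ l \<noteq> 0}"
    then obtain q where q: "q < N" "l = idx q" using assms by (auto simp: covered_def)
    then have "pos l < N" "idx (pos l) = l" "slot_row t (pos l) \<noteq> 0"
      using l idx_pos pos_less by (auto simp: slot_row_def)
    then show "l \<in> idx ` {x. x < N \<and> slot_row t x \<noteq> 0}" by (intro image_eqI[where x = "pos l"]) auto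
  qed
qed

lemma slot_row_nonzero: "x < N \<Longrightarrow> slot_row t x \<noteq> 0 \<Longrightarrow> slot_row t x = fst t $ idx x"
  by (auto simp: slot_row_def split: if_splits)

end

section \<open>Stored tuples\<close>

lemma stored_rowD:
  assumes "svl_stored p k ts st" "i < length ts"
  defines "P \<equiv> {narr st (p @ ''_ptr'') i ..< narr st (p @ ''_ptr'') (Suc i)}"
  shows "bij_betw (narr st (p @ ''_idx'')) P {l. l < dim_vec (fst (ts ! i)) \<and> fst (ts ! i) $ l \<noteq> 0}"
    and "q \<in> P \<Longrightarrow> rarr st (p @ ''_val'') q = fst (ts ! i) $ narr st (p @ ''_idx'') q"
    and "j < k \<Longrightarrow> rarr st (p @ ''_coef'') (i * k + j) = snd (ts ! i) $ j"
  using assms by (auto simp: svl_stored_def Let_def)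

lemma stored_ptr:
  "svl_stored p k ts st \<Longrightarrow> i \<le> length ts \<Longrightarrow> narr st (p @ ''_ptr'') i = (\<Sum>j<i. nnz (fst (ts ! j)))"
  by (simp add: svl_stored_def)

lemma stored_ptr_mono:
  "svl_stored p k ts st \<Longrightarrow> i \<le> j \<Longrightarrow> j \<le> length ts \<Longrightarrow>
    narr st (p @ ''_ptr'') i \<le> narr st (p @ ''_ptr'') j"
  by (simp add: stored_ptr sum_mono2)

text \<open>
  Every position of the value array lies in the segment of some row.
\<close>

lemma partial_sum_bracket:
  fixes f :: "nat \<Rightarrow> nat"
  shows "q < (\<Sum>j<n. f j) \<Longrightarrow> \<exists>i < n. (\<Sum>j<i. f j) \<le> q \<and> q < (\<Sum>j<Suc i. f j)"
proof (induction n)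
  case (Suc n)
  then show ?case by (cases "q < (\<Sum>j<n. f j)") (auto intro: less_SucI)
qed simp

lemma stored_position:
  assumes "svl_stored p k ts st" "q < narr st (p @ ''_ptr'') (length ts)"
  obtains i where "i < length ts"
    "q \<in> {narr st (p @ ''_ptr'') i ..< narr st (p @ ''_ptr'') (Suc i)}"
proof -
  have "q < (\<Sum>j<length ts. nnz (fst (ts ! j)))" using assms(2) stored_ptr[OF assms(1)] by simp
  from partial_sum_bracket[OF this] obtain i where i: "i < length ts"
    "(\<Sum>j<i. nnz (fst (ts ! j))) \<le> q" "q < (\<Sum>j<Suc i. nnz (fst (ts ! j)))"
    by blast
  then have "q \<in> {narr st (p @ ''_ptr'') i ..< narr st (p @ ''_ptr'') (Suc i)}"
    using stored_ptr[OF assms(1), of i] stored_ptr[OF assms(1), of "Suc i"] by simp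
  with i(1) show thesis by (rule that)
qed

lemma stored_idx_less:
  assumes st: "svl_stored p k ts st" and m: "\<forall>t \<in> set ts. fst t \<in> carrier_vec m"
    and q: "q < narr st (p @ ''_ptr'') (length ts)"
  shows "narr st (p @ ''_idx'') q < m"
proof -
  obtain i where i: "i < length ts" "q \<in> {narr st (p @ ''_ptr'') i ..< narr st (p @ ''_ptr'') (Suc i)}"
    using stored_position[OF st q] .
  then have "fst (ts ! i) \<in> carrier_vec m" using m by auto
  with bij_betwE[OF stored_rowD(1)[OF st i(1)]] i show ?thesis by auto
qed

lemma stored_support:
  assumes st: "svl_stored p k ts st" and i: "i < length ts"
    and l: "l < dim_vec (fst (ts ! i))" "fst (ts ! i) $ l \<noteq> 0"
  obtains q where "q < narr st (p @ ''_ptr'') (length ts)"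
    "q \<in> {narr st (p @ ''_ptr'') i ..< narr st (p @ ''_ptr'') (Suc i)}"
    "l = narr st (p @ ''_idx'') q"
proof -
  let ?P = "{narr st (p @ ''_ptr'') i ..< narr st (p @ ''_ptr'') (Suc i)}"
  have "l \<in> narr st (p @ ''_idx'') ` ?P"
    using l by (simp only: bij_betw_imp_surj_on[OF stored_rowD(1)[OF st i]] mem_Collect_eq simp_thms)
  then obtain q where q: "q \<in> ?P" "l = narr st (p @ ''_idx'') q" by (rule imageE)
  moreover have "narr st (p @ ''_ptr'') (Suc i) \<le> narr st (p @ ''_ptr'') (length ts)"
    using stored_ptr_mono[OF st, of "Suc i" "length ts"] i by simp
  ultimately show ?thesis using that by simp
qed

text \<open>
  A row is loaded by clearing it and writing each stored nonzero of \<open>b\<close> to the canonical slot of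
  its coordinate. A canonical slot that is hit receives the entry of its coordinate, one that
  is not hit belongs to a zero entry, and other slots are never hit.
\<close>

lemma (in slots) slot_row_scatter:
  assumes st: "svl_stored p k ts st" and i: "i < length ts" and t: "fst (ts ! i) \<in> carrier_vec m"
    and N: "N = narr st (p @ ''_ptr'') (length ts)" and idx: "idx = narr st (p @ ''_idx'')"
    and x: "x < N"
  defines "P \<equiv> {narr st (p @ ''_ptr'') i ..< narr st (p @ ''_ptr'') (Suc i)}"
  shows "slot_row (ts ! i) x = (if \<exists>q < N. q \<in> P \<and> pos (idx q) = x then fst (ts ! i) $ idx x else 0)"
proof (cases "pos (idx x) = x")
  case True
  show ?thesis
  proof (cases "fst (ts ! i) $ idx x = 0")
    case False
    then obtain q where "q < N" "q \<in> P" "idx x = idx q"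
      using stored_support[OF st i, of "idx x"] idx_less[OF x] t N idx P_def by auto
    then have "\<exists>q < N. q \<in> P \<and> pos (idx q) = x" using True by metis
    with True x show ?thesis by (simp add: slot_row_def)
  qed (use True x in \<open>simp add: slot_row_def\<close>)
next
  case False
  then have "\<not> (\<exists>q < N. q \<in> P \<and> pos (idx q) = x)" using idx_pos by metis
  with False x show ?thesis unfolding slot_row_def by (simp only: if_True if_False)
qed

text \<open>
  Appending a tuple to a stored list. The old segments of the sparse arrays end at the last pointer
  and the old coefficient rows end at \<open>length qs * k\<close>; memory beyond is free to change.
\<close>

lemma svl_stored_snoc:
  assumes old: "svl_stored p k qs st"
    and var: "nvar st' (p @ ''_len'') = Suc (length qs)" "nvar st' (p @ ''_k'') = k"
    and ptr: "narr st' (p @ ''_ptr'') = (narr st (p @ ''_ptr''))(Suc (length qs) := e)"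
    and e: "e = narr st (p @ ''_ptr'') (length qs) + nnz (fst q)"
    and keep: "\<And>x. x < narr st (p @ ''_ptr'') (length qs) \<Longrightarrow>
        narr st' (p @ ''_idx'') x = narr st (p @ ''_idx'') x \<and>
        rarr st' (p @ ''_val'') x = rarr st (p @ ''_val'') x"
      "\<And>x. x < length qs * k \<Longrightarrow> rarr st' (p @ ''_coef'') x = rarr st (p @ ''_coef'') x"
    and new: "bij_betw (narr st' (p @ ''_idx'')) {narr st (p @ ''_ptr'') (length qs) ..< e}
        {l. l < dim_vec (fst q) \<and> fst q $ l \<noteq> 0}"
      "\<And>x. narr st (p @ ''_ptr'') (length qs) \<le> x \<Longrightarrow> x < e \<Longrightarrow>
        rarr st' (p @ ''_val'') x = fst q $ narr st' (p @ ''_idx'') x"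
      "\<And>j. j < k \<Longrightarrow> rarr st' (p @ ''_coef'') (length qs * k + j) = snd q $ j"
  shows "svl_stored p k (qs @ [q]) st'"
  unfolding svl_stored_def
proof (intro conjI allI impI)
  let ?n = "length qs"
  show "nvar st' (p @ ''_len'') = length (qs @ [q])" "nvar st' (p @ ''_k'') = k" using var by auto
  fix i
  assume i: "i \<le> length (qs @ [q])"
  have "(\<Sum>j<i. nnz (fst (qs ! j))) = (\<Sum>j<i. nnz (fst ((qs @ [q]) ! j)))" if "i \<le> ?n" for i
    using that by (intro sum.cong) (auto simp: nth_append)
  then show "narr st' (p @ ''_ptr'') i = (\<Sum>j<i. nnz (fst ((qs @ [q]) ! j)))"
    using i stored_ptr[OF old] by (auto simp: ptr e le_Suc_eq)
next
  let ?n = "length qs"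
  fix i
  assume "i < length (qs @ [q])"
  then consider "i < ?n" | "i = ?n" by fastforce
  then show "let b = fst ((qs @ [q]) ! i); c = snd ((qs @ [q]) ! i);
            P = {narr st' (p @ ''_ptr'') i ..< narr st' (p @ ''_ptr'') (Suc i)}
        in bij_betw (narr st' (p @ ''_idx'')) P {l. l < dim_vec b \<and> b $ l \<noteq> 0} \<and>
           (\<forall>q \<in> P. rarr st' (p @ ''_val'') q = b $ narr st' (p @ ''_idx'') q) \<and>
           (\<forall>j < k. rarr st' (p @ ''_coef'') (i * k + j) = c $ j)"
  proof cases
    case 1
    let ?P = "{narr st (p @ ''_ptr'') i ..< narr st (p @ ''_ptr'') (Suc i)}"
    have less: "x < narr st (p @ ''_ptr'') ?n" if "x \<in> ?P" for x
      using that stored_ptr_mono[OF old, of "Suc i" ?n] 1 by simp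
    have "i * k + j < ?n * k" if "j < k" for j
    proof -
      have "i * k + j < Suc i * k" using that by simp
      also have "\<dots> \<le> ?n * k" using 1 by (intro mult_le_mono1) simp
      finally show ?thesis .
    qed
    moreover have "bij_betw (narr st' (p @ ''_idx'')) ?P {l. l < dim_vec (fst (qs ! i)) \<and> fst (qs ! i) $ l \<noteq> 0}"
      using stored_rowD(1)[OF old 1] less keep(1) by (subst bij_betw_cong) auto
    ultimately show ?thesis
      using 1 stored_rowD(2,3)[OF old 1] less keep by (simp add: ptr nth_append)
  qed (use new in \<open>simp add: ptr\<close>)
qed

section \<open>Timed reasoning about programs\<close>

text \<open>
  The postcondition receives the exact running time, so that straight-line code is evaluated by
  rewriting with the equations \<open>wp_simps\<close>, while a \<open>For\<close> loop is handled by an invariant.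
\<close>

definition wp :: "com \<Rightarrow> state \<Rightarrow> (nat \<Rightarrow> state \<Rightarrow> bool) \<Rightarrow> bool" where
  "wp c st Q \<longleftrightarrow> (\<exists>t st'. exec c st t st' \<and> Q t st')"

lemma wp_Skip: "wp Skip st Q \<longleftrightarrow> Q 1 st"
  unfolding wp_def using exec.Skip exec_deterministic by metis

lemma wp_NAssign:
  "wp (NAssign x e) st Q \<longleftrightarrow> Q (1 + ncost e) (st\<lparr>nvar := (nvar st)(x := nval e st)\<rparr>)"
  unfolding wp_def using exec.NAssign exec_deterministic by metis

lemma wp_RAssign:
  "wp (RAssign x e) st Q \<longleftrightarrow> Q (1 + rcost e) (st\<lparr>rvar := (rvar st)(x := rval e st)\<rparr>)"
  unfolding wp_def using exec.RAssign exec_deterministic by metis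

lemma wp_NStore:
  "wp (NStore a i e) st Q \<longleftrightarrow> Q (1 + ncost i + ncost e)
     (st\<lparr>narr := (narr st)(a := (narr st a)(nval i st := nval e st))\<rparr>)"
  unfolding wp_def using exec.NStore exec_deterministic by metis

lemma wp_RStore:
  "wp (RStore a i e) st Q \<longleftrightarrow> Q (1 + ncost i + rcost e)
     (st\<lparr>rarr := (rarr st)(a := (rarr st a)(nval i st := rval e st))\<rparr>)"
  unfolding wp_def using exec.RStore exec_deterministic by metis

lemma wp_Seq: "wp (Seq c d) st Q \<longleftrightarrow> wp c st (\<lambda>t s. wp d s (\<lambda>t' s'. Q (t + t') s'))"
  unfolding wp_def by (fastforce intro: exec.Seq elim: exec.cases)

lemma wp_Cond:
  "wp (Cond b c d) st Q \<longleftrightarrow>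
     (if bval b st then wp c st (\<lambda>t. Q (1 + bcost b + t)) else wp d st (\<lambda>t. Q (1 + bcost b + t)))"
proof
  assume "wp (Cond b c d) st Q"
  then obtain t s where "exec (Cond b c d) st t s" "Q t s" unfolding wp_def by blast
  then show "if bval b st then wp c st (\<lambda>t. Q (1 + bcost b + t)) else wp d st (\<lambda>t. Q (1 + bcost b + t))"
    unfolding wp_def by cases auto
next
  assume "if bval b st then wp c st (\<lambda>t. Q (1 + bcost b + t)) else wp d st (\<lambda>t. Q (1 + bcost b + t))"
  then show "wp (Cond b c d) st Q"
    unfolding wp_def using exec.CondTrue exec.CondFalse by (metis (full_types))
qed

lemmas wp_simps = wp_Skip wp_NAssign wp_RAssign wp_NStore wp_RStore wp_Seq wp_Cond

lemma wp_mono: "wp c st P \<Longrightarrow> (\<And>t s. P t s \<Longrightarrow> Q t s) \<Longrightarrow> wp c st Q"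
  unfolding wp_def by blast

lemma wp_SeqI:
  "wp c st P \<Longrightarrow> (\<And>t s. P t s \<Longrightarrow> wp d s (\<lambda>t' s'. Q (t + t') s')) \<Longrightarrow> wp (Seq c d) st Q"
  unfolding wp_Seq by (rule wp_mono)

definition For :: "string \<Rightarrow> string \<Rightarrow> com \<Rightarrow> com" where
  "For x y body = Seq (NAssign x (NLit 0))
     (While (NLess (NVar x) (NVar y)) (Seq body (NAssign x (NAdd (NVar x) (NLit 1)))))"

text \<open>
  The invariant is indexed by the number of completed rounds. Each round spends \<open>4\<close> units on the test
  and \<open>4\<close> on the increment; the initialisation and the final test cost \<open>6\<close>.
\<close>

lemma wp_For:
  assumes init: "J 0 (st\<lparr>nvar := (nvar st)(x := 0)\<rparr>)" and n: "nvar st y = n" and "x \<noteq> y"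
    and step: "\<And>i s. i < n \<Longrightarrow> nvar s x = i \<Longrightarrow> nvar s y = n \<Longrightarrow> J i s \<Longrightarrow>
      wp body s (\<lambda>t s'. t \<le> T \<and> nvar s' x = i \<and> nvar s' y = n \<and>
        J (Suc i) (s'\<lparr>nvar := (nvar s')(x := Suc i)\<rparr>))"
  shows "wp (For x y body) st (\<lambda>t s. t \<le> (n + 1) * (T + 8) \<and> J n s)"
proof -
  let ?inc = "NAssign x (NAdd (NVar x) (NLit 1))"
  let ?loop = "While (NLess (NVar x) (NVar y)) (Seq body ?inc)"
  have loop: "\<exists>t s'. exec ?loop s t s' \<and> t \<le> (n - i) * (T + 8) + 4 \<and> J n s'"
    if "i \<le> n" "nvar s x = i" "nvar s y = n" "J i s" for i s
    using that
  proof (induction "n - i" arbitrary: i s)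
    case 0
    then have "exec ?loop s (1 + bcost (NLess (NVar x) (NVar y))) s"
      by (intro exec.WhileFalse) simp
    then show ?case using 0 by fastforce
  next
    case (Suc d)
    then have "i < n" by simp
    from step[OF this Suc.prems(2-4)] obtain t s1 where body: "exec body s t s1" "t \<le> T"
      "nvar s1 x = i" "nvar s1 y = n" "J (Suc i) (s1\<lparr>nvar := (nvar s1)(x := Suc i)\<rparr>)"
      unfolding wp_def by blast
    let ?s2 = "s1\<lparr>nvar := (nvar s1)(x := Suc i)\<rparr>"
    have "exec ?inc s1 4 ?s2"
      using exec.NAssign[of x "NAdd (NVar x) (NLit 1)" s1] body(3) by (simp add: numeral_eq_Suc)
    with body(1) have 1: "exec (Seq body ?inc) s (t + 4) ?s2" by (rule exec.Seq)
    have "d = n - Suc i" "Suc i \<le> n" using Suc.hyps(2) by auto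
    moreover have "nvar ?s2 x = Suc i" "nvar ?s2 y = n" using body \<open>x \<noteq> y\<close> by auto
    ultimately obtain t' s' where
      2: "exec ?loop ?s2 t' s'" "t' \<le> (n - Suc i) * (T + 8) + 4" "J n s'"
      using Suc.hyps(1)[of "Suc i" ?s2] body(5) by blast
    have "exec ?loop s (1 + bcost (NLess (NVar x) (NVar y)) + (t + 4) + t') s'"
      by (rule exec.WhileTrue[OF _ 1 2(1)]) (use Suc.prems \<open>i < n\<close> in simp)
    moreover have "n - i = Suc (n - Suc i)" using \<open>i < n\<close> by simp
    ultimately show ?case using 2 body(2) by (fastforce simp: algebra_simps)
  qed
  let ?s = "st\<lparr>nvar := (nvar st)(x := 0)\<rparr>"
  from loop[of 0 ?s] obtain t s' where
    "exec ?loop ?s t s'" "t \<le> n * (T + 8) + 4" "J n s'" using init n \<open>x \<noteq> y\<close> by auto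
  moreover have "exec (NAssign x (NLit 0)) st 2 ?s"
    using exec.NAssign[of x "NLit 0" st] by (simp add: numeral_2_eq_2)
  ultimately have "exec (For x y body) st (2 + t) s'" unfolding For_def by (blast intro: exec.Seq)
  then show ?thesis using \<open>t \<le> n * (T + 8) + 4\<close> \<open>J n s'\<close> unfolding wp_def
    by (intro exI[of _ "2 + t"] exI[of _ s']) simp
qed

text \<open>
  Frame condition. One set of names serves for variables and arrays of both sorts.
\<close>

definition unchanged :: "string set \<Rightarrow> state \<Rightarrow> state \<Rightarrow> bool" where
  "unchanged V st s \<longleftrightarrow> (\<forall>x. x \<notin> V \<longrightarrow> nvar s x = nvar st x \<and> rvar s x = rvar st x \<and>
     narr s x = narr st x \<and> rarr s x = rarr st x)"

lemma unchangedD: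
  assumes "unchanged V st s" "x \<notin> V"
  shows "nvar s x = nvar st x" "rvar s x = rvar st x" "narr s x = narr st x" "rarr s x = rarr st x"
  using assms by (auto simp: unchanged_def)

lemma svl_stored_unchanged:
  assumes "svl_stored p k ts st" "unchanged V st s"
    and "{p @ ''_len'', p @ ''_k'', p @ ''_ptr'', p @ ''_idx'', p @ ''_val'', p @ ''_coef''} \<inter> V = {}"
  shows "svl_stored p k ts s"
proof -
  have "nvar s (p @ ''_len'') = nvar st (p @ ''_len'')" "nvar s (p @ ''_k'') = nvar st (p @ ''_k'')"
    "narr s (p @ ''_ptr'') = narr st (p @ ''_ptr'')" "narr s (p @ ''_idx'') = narr st (p @ ''_idx'')"
    "rarr s (p @ ''_val'') = rarr st (p @ ''_val'')" "rarr s (p @ ''_coef'') = rarr st (p @ ''_coef'')"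
    using assms(3) by (simp_all add: unchangedD[OF assms(2)])
  note eqs = this
  show ?thesis using assms(1) unfolding svl_stored_def eqs .
qed

section \<open>The program\<close>

text \<open>
  Names used by the program: \<open>w\<close> is the current residual row, \<open>Q\<close> holds the rows of the basis found so
  far, \<open>L = N + k\<close> is the row length, and \<open>h\<close> is the last product. The offsets \<open>pb\<close> and \<open>rb\<close> point to
  the row of \<open>Q\<close> being subtracted and to the first free row, \<open>ib\<close> and \<open>rk\<close> to rows of the input
  and output coefficients, and \<open>o\<close> to the next free position of the sparse output.
\<close>

definition index_slots :: com where
  "index_slots = For ''x'' ''N'' (NStore ''pos'' (NGet ''in_idx'' (NVar ''x'')) (NVar ''x''))"

definition load_dense :: com where
  "load_dense = For ''x'' ''L'' (Cond (NLess (NVar ''x'') (NVar ''N''))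
     (RStore ''w'' (NVar ''x'') (RLit 0))
     (RStore ''w'' (NVar ''x'')
       (RGet ''in_coef'' (NAdd (NVar ''ib'') (NSub (NVar ''x'') (NVar ''N''))))))"

definition load_sparse :: com where
  "load_sparse = For ''x'' ''N''
     (Cond (BAnd (BNot (NLess (NVar ''x'') (NGet ''in_ptr'' (NVar ''i''))))
                 (NLess (NVar ''x'') (NGet ''in_ptr'' (NAdd (NVar ''i'') (NLit 1)))))
       (RStore ''w'' (NGet ''pos'' (NGet ''in_idx'' (NVar ''x''))) (RGet ''in_val'' (NVar ''x'')))
       Skip)"

definition dot :: "string \<Rightarrow> nexp \<Rightarrow> com" where
  "dot a e = Seq (RAssign ''h'' (RLit 0)) (For ''x'' ''L''
     (let p = RMul (RGet a (NAdd e (NVar ''x''))) (RGet ''w'' (NVar ''x''))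
      in Cond (NLess (NVar ''x'') (NVar ''N''))
           (RAssign ''h'' (RAdd (RVar ''h'') p)) (RAssign ''h'' (RSub (RVar ''h'') p))))"

definition subtract_row :: com where
  "subtract_row = For ''x'' ''L'' (RStore ''w'' (NVar ''x'')
     (RSub (RGet ''w'' (NVar ''x''))
       (RMul (RVar ''h'') (RGet ''Q'' (NAdd (NVar ''pb'') (NVar ''x''))))))"

definition project_row :: com where
  "project_row = Seq (NAssign ''pb'' (NLit 0)) (For ''p'' ''out_len''
     (Seq (dot ''Q'' (NVar ''pb'')) (Seq subtract_row
       (NAssign ''pb'' (NAdd (NVar ''pb'') (NVar ''L''))))))"

definition normalize_row :: com where
  "normalize_row = For ''x'' ''L'' (Seq
     (RStore ''w'' (NVar ''x'') (RDiv (RGet ''w'' (NVar ''x'')) (RVar ''h'')))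
     (RStore ''Q'' (NAdd (NVar ''rb'') (NVar ''x'')) (RGet ''w'' (NVar ''x''))))"

definition emit_sparse :: com where
  "emit_sparse = For ''x'' ''N'' (Cond (REq (RGet ''w'' (NVar ''x'')) (RLit 0)) Skip
     (Seq (NStore ''out_idx'' (NVar ''o'') (NGet ''in_idx'' (NVar ''x'')))
     (Seq (RStore ''out_val'' (NVar ''o'') (RGet ''w'' (NVar ''x'')))
       (NAssign ''o'' (NAdd (NVar ''o'') (NLit 1))))))"

definition emit_dense :: com where
  "emit_dense = For ''x'' ''out_k'' (RStore ''out_coef'' (NAdd (NVar ''rk'') (NVar ''x''))
     (RGet ''w'' (NAdd (NVar ''N'') (NVar ''x''))))"

definition append_row :: com where
  "append_row = Seq (RAssign ''h'' (RSqrt (RVar ''h''))) (Seq normalize_row (Seq emit_sparse (Seq emit_dense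
     (Seq (NAssign ''out_len'' (NAdd (NVar ''out_len'') (NLit 1)))
     (Seq (NAssign ''rb'' (NAdd (NVar ''rb'') (NVar ''L'')))
     (Seq (NAssign ''rk'' (NAdd (NVar ''rk'') (NVar ''out_k'')))
       (NStore ''out_ptr'' (NVar ''out_len'') (NVar ''o''))))))))"

definition process_row :: com where
  "process_row = Seq load_dense (Seq load_sparse
     (Seq (NAssign ''ib'' (NAdd (NVar ''ib'') (NVar ''out_k'')))
     (Seq project_row (Seq (dot ''w'' (NLit 0))
       (Cond (REq (RVar ''h'') (RLit 0)) Skip append_row)))))"

definition initialise :: com where
  "initialise = Seq (NAssign ''N'' (NGet ''in_ptr'' (NVar ''in_len'')))
     (Seq (NAssign ''L'' (NAdd (NVar ''N'') (NVar ''in_k'')))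
     (Seq (NAssign ''out_k'' (NVar ''in_k'')) (Seq (NAssign ''out_len'' (NLit 0))
     (Seq (NAssign ''rb'' (NLit 0)) (Seq (NAssign ''rk'' (NLit 0)) (Seq (NAssign ''ib'' (NLit 0))
     (Seq (NAssign ''o'' (NLit 0)) (Seq (NStore ''out_ptr'' (NLit 0) (NLit 0)) index_slots))))))))"

definition gram_schmidt_prog :: com where
  "gram_schmidt_prog = Seq initialise (For ''i'' ''in_len'' process_row)"

section \<open>Loops\<close>

text \<open>
  Later writes may move the canonical slot of a coordinate, but the slot recorded always has that
  coordinate. Only addresses written by this loop are described.
\<close>

lemma index_slots_spec:
  assumes "nvar st ''N'' = N"
  shows "wp index_slots st (\<lambda>t s. t \<le> 20 * (N + 1) \<and> unchanged {''x'', ''pos''} st s \<and>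
    (\<forall>q < N. narr s ''pos'' (narr st ''in_idx'' q) < N \<and>
      narr st ''in_idx'' (narr s ''pos'' (narr st ''in_idx'' q)) = narr st ''in_idx'' q))"
proof -
  let ?idx = "narr st ''in_idx''"
  let ?J = "\<lambda>y s. unchanged {''x'', ''pos''} st s \<and>
    (\<forall>q < y. narr s ''pos'' (?idx q) < y \<and> ?idx (narr s ''pos'' (?idx q)) = ?idx q)"
  have "wp index_slots st (\<lambda>t s. t \<le> (N + 1) * (5 + 8) \<and> ?J N s)"
    unfolding index_slots_def
  proof (rule wp_For[where J = ?J and n = N and T = 5], goal_cases)
    case (4 y s)
    then have u: "narr s ''in_idx'' = ?idx" by (auto simp: unchangedD)
    from 4 show ?case
      by (auto simp: wp_simps u unchanged_def less_Suc_eq)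
  qed (use assms in \<open>auto simp: unchanged_def\<close>)
  then show ?thesis by (rule wp_mono) auto
qed

lemma bij_betw_append:
  fixes f :: "nat \<Rightarrow> 'a"
  assumes "bij_betw f {a..<b} A" "a \<le> b" "v \<notin> A"
  shows "bij_betw (f(b := v)) {a..<Suc b} (insert v A)"
proof -
  have "bij_betw (f(b := v)) {a..<b} A"
    using assms(1) by (subst bij_betw_cong[of _ _ f]) auto
  moreover have "{a..<Suc b} = insert b {a..<b}" using assms(2) by auto
  ultimately show ?thesis
    using notIn_Un_bij_betw[of b "{a..<b}" "f(b := v)" A] assms(3) by simp
qed

context slots
begin

definition ready :: "state \<Rightarrow> bool" where
  "ready s \<longleftrightarrow> nvar s ''N'' = N \<and> nvar s ''L'' = N + k \<and> nvar s ''out_k'' = k \<and>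
     narr s ''in_idx'' = idx \<and> narr s ''pos'' = pos"

definition holds :: "state \<Rightarrow> string \<Rightarrow> nat \<Rightarrow> svl \<Rightarrow> bool" where
  "holds s a off t \<longleftrightarrow> (\<forall>x < N + k. rarr s a (off + x) = slot_row t x)"

lemma ready_unchanged:
  "ready st \<Longrightarrow> unchanged V st s \<Longrightarrow> {''N'', ''L'', ''out_k'', ''in_idx'', ''pos''} \<inter> V = {} \<Longrightarrow> ready s"
  by (auto simp: ready_def unchanged_def)

lemma holds_unchanged: "holds st a off t \<Longrightarrow> unchanged V st s \<Longrightarrow> a \<notin> V \<Longrightarrow> holds s a off t"
  by (simp add: holds_def unchanged_def)

text \<open>
  The address expression \<open>e\<close> is the offset of the row \<open>u\<close> in the array \<open>a\<close>. With the row \<open>w\<close> itself as the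
  other operand the same code computes a squared norm.
\<close>

lemma dot_spec:
  assumes r: "ready st" and u: "holds st a (nval e st) u" "covered u"
    and w: "holds st ''w'' 0 t" "covered t"
    and e: "\<And>s. unchanged {''x'', ''h''} st s \<Longrightarrow> nval e s = nval e st" "ncost e = 1"
    and a: "a \<noteq> ''x''" "a \<noteq> ''h''"
  shows "wp (dot a e) st (\<lambda>t' s. t' \<le> 30 * (N + k + 1) \<and> unchanged {''x'', ''h''} st s \<and>
    rvar s ''h'' = svl_inner u t)"
proof -
  let ?f = "\<lambda>x. if x < N then slot_row u x * slot_row t x else - (slot_row u x * slot_row t x)"
  let ?J = "\<lambda>y s. unchanged {''x'', ''h''} st s \<and> rvar s ''h'' = (\<Sum>x<y. ?f x)"
  let ?st = "st\<lparr>rvar := (rvar st)(''h'' := 0)\<rparr>"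
  let ?p = "RMul (RGet a (NAdd e (NVar ''x''))) (RGet ''w'' (NVar ''x''))"
  have "wp (For ''x'' ''L'' (Cond (NLess (NVar ''x'') (NVar ''N''))
           (RAssign ''h'' (RAdd (RVar ''h'') ?p)) (RAssign ''h'' (RSub (RVar ''h'') ?p))))
      ?st (\<lambda>t' s. t' \<le> (N + k + 1) * (16 + 8) \<and> ?J (N + k) s)"
  proof (rule wp_For[where J = ?J and n = "N + k" and T = 16], goal_cases)
    case (4 y s)
    have "nval e s = nval e st" using e(1) 4 by blast
    then have "rarr s a (nval e s + y) = slot_row u y" "rarr s ''w'' y = slot_row t y" "nvar s ''N'' = N"
      using 4 u w r a by (auto simp: holds_def ready_def unchangedD)
    with 4 show ?case
      by (auto simp: wp_simps e(2) unchanged_def)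
  qed (use r in \<open>auto simp: unchanged_def ready_def\<close>)
  then show ?thesis
    by (simp only: dot_def Let_def wp_Seq wp_RAssign rval.simps rcost.simps of_nat_0)
      (erule wp_mono, simp add: signed_sum_rows[OF u(2) w(2)])
qed

lemma subtract_row_spec:
  assumes r: "ready st" and q: "holds st ''Q'' (nvar st ''pb'') q" "covered q"
    and w: "holds st ''w'' 0 t" "covered t" and h: "rvar st ''h'' = svl_inner q t"
  shows "wp subtract_row st (\<lambda>t' s. t' \<le> 30 * (N + k + 1) \<and> unchanged {''x'', ''w''} st s \<and>
    holds s ''w'' 0 (svl_reduce t q))"
proof -
  let ?J = "\<lambda>y s. unchanged {''x'', ''w''} st s \<and>
    (\<forall>x < N + k. rarr s ''w'' x = (if x < y then slot_row (svl_reduce t q) x else slot_row t x))"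
  have "wp subtract_row st (\<lambda>t' s. t' \<le> (N + k + 1) * (14 + 8) \<and> ?J (N + k) s)"
    unfolding subtract_row_def
  proof (rule wp_For[where J = ?J and n = "N + k" and T = 14], goal_cases)
    case (4 y s)
    have "rarr s ''Q'' (nvar s ''pb'' + y) = slot_row q y" "rvar s ''h'' = svl_inner q t"
      using 4 q h by (auto simp: holds_def unchangedD)
    with 4 show ?case
      by (auto simp: wp_simps unchanged_def slot_row_reduce[OF w(2) q(2)])
  qed (use r w in \<open>auto simp: unchanged_def ready_def holds_def\<close>)
  then show ?thesis by (rule wp_mono) (auto simp: holds_def)
qed

lemma project_row_spec:
  assumes r: "ready st" and len: "nvar st ''out_len'' = length qs"
    and Q: "\<forall>p < length qs. holds st ''Q'' (p * (N + k)) (qs ! p)" "\<forall>q \<in> set qs. covered q"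
    and w: "holds st ''w'' 0 t" "covered t"
  shows "wp project_row st (\<lambda>t' s. t' \<le> (length qs + 1) * (80 * (N + k + 1)) \<and>
    unchanged {''x'', ''h'', ''w'', ''p'', ''pb''} st s \<and> holds s ''w'' 0 (foldl svl_reduce t qs))"
proof -
  let ?V = "{''x'', ''h'', ''w'', ''p'', ''pb''}"
  let ?J = "\<lambda>y s. unchanged ?V st s \<and> nvar s ''pb'' = y * (N + k) \<and>
    holds s ''w'' 0 (foldl svl_reduce t (take y qs))"
  let ?body = "Seq (dot ''Q'' (NVar ''pb'')) (Seq subtract_row
       (NAssign ''pb'' (NAdd (NVar ''pb'') (NVar ''L''))))"
  have "wp (For ''p'' ''out_len'' ?body) (st\<lparr>nvar := (nvar st)(''pb'' := 0)\<rparr>)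
      (\<lambda>t' s. t' \<le> (length qs + 1) * ((60 * (N + k + 1) + 4) + 8) \<and> ?J (length qs) s)"
  proof (rule wp_For[where J = ?J and n = "length qs" and T = "60 * (N + k + 1) + 4"], goal_cases)
    case (4 y s)
    let ?t = "foldl svl_reduce t (take y qs)"
    have rs: "ready s" by (rule ready_unchanged[OF r]) (use 4 in auto)
    have q: "holds s ''Q'' (nvar s ''pb'') (qs ! y)" "covered (qs ! y)"
      using 4 Q by (auto simp: holds_def unchangedD)
    have t: "holds s ''w'' 0 ?t" "covered ?t"
      using 4 Q w by (auto intro!: covered_residual dest: in_set_takeD)
    have "wp (dot ''Q'' (NVar ''pb'')) s (\<lambda>t' s1. t' \<le> 30 * (N + k + 1) \<and>
        unchanged {''x'', ''h''} s s1 \<and> rvar s1 ''h'' = svl_inner (qs ! y) ?t)"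
      by (rule dot_spec[OF rs _ q(2) t]) (use q in \<open>auto simp: unchangedD\<close>)
    then show ?case unfolding wp_Seq
    proof (rule wp_mono)
      fix t1 s1
      assume 1: "t1 \<le> 30 * (N + k + 1) \<and> unchanged {''x'', ''h''} s s1 \<and>
        rvar s1 ''h'' = svl_inner (qs ! y) ?t"
      then have u1: "unchanged {''x'', ''h''} s s1" by simp
      have "wp subtract_row s1 (\<lambda>t' s2. t' \<le> 30 * (N + k + 1) \<and> unchanged {''x'', ''w''} s1 s2 \<and>
          holds s2 ''w'' 0 (svl_reduce ?t (qs ! y)))"
        by (rule subtract_row_spec[OF ready_unchanged[OF rs u1] _ q(2) holds_unchanged[OF t(1) u1] t(2)])
          (use q 1 holds_unchanged[OF q(1) u1] in \<open>auto simp: unchangedD[OF u1]\<close>)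
      then show "wp subtract_row s1 (\<lambda>ta sa.
          wp (NAssign ''pb'' (NAdd (NVar ''pb'') (NVar ''L''))) sa
            (\<lambda>t' s'. t1 + (ta + t') \<le> 60 * (N + k + 1) + 4 \<and> nvar s' ''p'' = y \<and>
              nvar s' ''out_len'' = length qs \<and>
              ?J (Suc y) (s'\<lparr>nvar := (nvar s')(''p'' := Suc y)\<rparr>)))"
      proof (rule wp_mono)
        fix t2 s2
        assume 2: "t2 \<le> 30 * (N + k + 1) \<and> unchanged {''x'', ''w''} s1 s2 \<and>
          holds s2 ''w'' 0 (svl_reduce ?t (qs ! y))"
        then have "unchanged ?V st s2" using 4 u1 unfolding unchanged_def by simp
        moreover have "nvar s2 ''pb'' = y * (N + k)" "nvar s2 ''L'' = N + k" "nvar s2 ''p'' = y"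
          "nvar s2 ''out_len'' = length qs"
          using 2 u1 4 rs by (auto simp: unchangedD ready_def)
        ultimately show "wp (NAssign ''pb'' (NAdd (NVar ''pb'') (NVar ''L''))) s2
            (\<lambda>t' s'. t1 + (t2 + t') \<le> 60 * (N + k + 1) + 4 \<and> nvar s' ''p'' = y \<and>
              nvar s' ''out_len'' = length qs \<and>
              ?J (Suc y) (s'\<lparr>nvar := (nvar s')(''p'' := Suc y)\<rparr>))"
          using 1 2 4(1) by (auto simp: wp_simps unchanged_def holds_def take_Suc_conv_app_nth)
      qed
    qed
  qed (use len w in \<open>auto simp: unchanged_def holds_def\<close>)
  then show ?thesis
    by (simp only: project_row_def wp_Seq[of "NAssign ''pb'' (NLit 0)"] wp_NAssign nval.simps ncost.simps)
      (erule wp_mono, auto simp: algebra_simps)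
qed


lemma load_dense_spec:
  assumes r: "ready st" and st: "svl_stored ''in'' k ts st" and i: "i < length ts"
    and ib: "nvar st ''ib'' = i * k"
  shows "wp load_dense st (\<lambda>t' s. t' \<le> 30 * (N + k + 1) \<and> unchanged {''x'', ''w''} st s \<and>
    (\<forall>x < N + k. rarr s ''w'' x = (if x < N then 0 else slot_row (ts ! i) x)))"
proof -
  let ?J = "\<lambda>y s. unchanged {''x'', ''w''} st s \<and>
    (\<forall>x < y. rarr s ''w'' x = (if x < N then 0 else slot_row (ts ! i) x))"
  have "wp load_dense st (\<lambda>t' s. t' \<le> (N + k + 1) * (14 + 8) \<and> ?J (N + k) s)"
    unfolding load_dense_def
  proof (rule wp_For[where J = ?J and n = "N + k" and T = 14], goal_cases)
    case (4 y s)
    have u: "unchanged {''x'', ''w''} st s" using 4 by blast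
    have "nvar s ''N'' = N" "nvar s ''ib'' = i * k" "rarr s ''in_coef'' = rarr st ''in_coef''"
      using r ib by (simp_all add: ready_def unchangedD[OF u])
    moreover have "rarr st ''in_coef'' (i * k + (y - N)) = slot_row (ts ! i) y" if "\<not> y < N"
      using stored_rowD(3)[OF st i, of "y - N"] 4(1) that by (simp add: slot_row_def)
    ultimately show ?case using 4
      by (auto simp: wp_simps unchanged_def less_Suc_eq)
  qed (use r in \<open>auto simp: unchanged_def ready_def\<close>)
  then show ?thesis by (rule wp_mono) auto
qed

lemma load_sparse_spec:
  assumes r: "ready st" and st: "svl_stored ''in'' k ts st" and i: "i < length ts"
    and N: "narr st ''in_ptr'' (length ts) = N" and t: "fst (ts ! i) \<in> carrier_vec m"
    and iv: "nvar st ''i'' = i"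
    and w: "\<forall>x < N + k. rarr st ''w'' x = (if x < N then 0 else slot_row (ts ! i) x)"
  shows "wp load_sparse st (\<lambda>t' s. t' \<le> 40 * (N + k + 1) \<and> unchanged {''x'', ''w''} st s \<and>
    holds s ''w'' 0 (ts ! i))"
proof -
  let ?P = "{narr st ''in_ptr'' i ..< narr st ''in_ptr'' (Suc i)}"
  have idx: "narr st ''in_idx'' = idx" using r by (simp add: ready_def)
  \<comment> \<open>After \<open>y\<close> rounds the nonzeros stored at positions below \<open>y\<close> have been written.\<close>
  define hit where "hit y x \<longleftrightarrow> (\<exists>q < y. q \<in> ?P \<and> pos (idx q) = x)" for y x
  have hit_0: "\<not> hit 0 x" for x by (simp add: hit_def)
  have hit_Suc: "hit (Suc y) x \<longleftrightarrow> hit y x \<or> y \<in> ?P \<and> pos (idx y) = x" for y x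
    by (auto simp: hit_def less_Suc_eq)
  let ?J = "\<lambda>y s. unchanged {''x'', ''w''} st s \<and>
    (\<forall>x < N + k. rarr s ''w'' x = (if x < N then if hit y x then fst (ts ! i) $ idx x else 0
       else slot_row (ts ! i) x))"
  have "wp load_sparse st (\<lambda>t' s. t' \<le> (N + 1) * (24 + 8) \<and> ?J N s)"
    unfolding load_sparse_def
  proof (rule wp_For[where J = ?J and n = N and T = 24], goal_cases)
    case (4 y s)
    have u: "unchanged {''x'', ''w''} st s" using 4 by blast
    have "nvar s ''i'' = i" "narr s ''in_ptr'' = narr st ''in_ptr''" "narr s ''in_idx'' = idx"
      "narr s ''pos'' = pos" "rarr s ''in_val'' = rarr st ''in_val''"
      using r iv by (simp_all add: ready_def unchangedD[OF u])
    moreover have "rarr st ''in_val'' y = fst (ts ! i) $ idx y" if "y \<in> ?P"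
      using stored_rowD(2)[OF st i] that idx by simp
    moreover have "pos (idx y) < N" "idx (pos (idx y)) = idx y" using pos_less idx_pos 4(1) by auto
    ultimately show ?case using 4
      by (cases "y \<in> ?P") (simp_all add: wp_simps unchanged_def hit_Suc)
  qed (use r w in \<open>simp_all add: unchanged_def ready_def hit_0\<close>)
  then show ?thesis
  proof (rule wp_mono)
    fix t' s assume 1: "t' \<le> (N + 1) * (24 + 8) \<and> ?J N s"
    have "slot_row (ts ! i) x = (if \<exists>q < N. q \<in> ?P \<and> pos (idx q) = x then fst (ts ! i) $ idx x else 0)"
      if "x < N" for x
      using slot_row_scatter[OF st i t] N idx that by simp
    then have "slot_row (ts ! i) x = (if hit N x then fst (ts ! i) $ idx x else 0)" if "x < N" for x
      using that by (simp add: hit_def)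
    with 1 show "t' \<le> 40 * (N + k + 1) \<and> unchanged {''x'', ''w''} st s \<and> holds s ''w'' 0 (ts ! i)"
      by (simp add: holds_def)
  qed
qed

lemma normalize_row_spec:
  assumes r: "ready st" and w: "holds st ''w'' 0 t" "covered t"
    and h: "rvar st ''h'' = sqrt (svl_inner t t)"
  shows "wp normalize_row st (\<lambda>t' s. t' \<le> 30 * (N + k + 1) \<and> unchanged {''x'', ''w'', ''Q''} st s \<and>
    holds s ''w'' 0 (svl_normalize t) \<and> holds s ''Q'' (nvar st ''rb'') (svl_normalize t) \<and>
    (\<forall>z < nvar st ''rb''. rarr s ''Q'' z = rarr st ''Q'' z))"
proof -
  let ?J = "\<lambda>y s. unchanged {''x'', ''w'', ''Q''} st s \<and>
    (\<forall>x < N + k. rarr s ''w'' x = (if x < y then slot_row (svl_normalize t) x else slot_row t x)) \<and>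
    (\<forall>x < y. rarr s ''Q'' (nvar st ''rb'' + x) = slot_row (svl_normalize t) x) \<and>
    (\<forall>z < nvar st ''rb''. rarr s ''Q'' z = rarr st ''Q'' z)"
  have "wp normalize_row st (\<lambda>t' s. t' \<le> (N + k + 1) * (14 + 8) \<and> ?J (N + k) s)"
    unfolding normalize_row_def
  proof (rule wp_For[where J = ?J and n = "N + k" and T = 14], goal_cases)
    case (4 y s)
    have u: "unchanged {''x'', ''w'', ''Q''} st s" using 4 by blast
    have "nvar s ''rb'' = nvar st ''rb''" "rvar s ''h'' = sqrt (svl_inner t t)"
      using h by (simp_all add: unchangedD[OF u])
    with 4 show ?case
      by (auto simp: wp_simps unchanged_def slot_row_normalize[OF w(2)])
  qed (use r w in \<open>auto simp: unchanged_def ready_def holds_def\<close>)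
  then show ?thesis by (rule wp_mono) (auto simp: holds_def)
qed

lemma emit_sparse_spec:
  assumes r: "ready st" and w: "holds st ''w'' 0 t" "covered t"
  shows "wp emit_sparse st (\<lambda>t' s. t' \<le> 40 * (N + k + 1) \<and>
    unchanged {''x'', ''o'', ''out_idx'', ''out_val''} st s \<and>
    nvar s ''o'' = nvar st ''o'' + nnz (fst t) \<and>
    bij_betw (narr s ''out_idx'') {nvar st ''o'' ..< nvar s ''o''}
      {l. l < dim_vec (fst t) \<and> fst t $ l \<noteq> 0} \<and>
    (\<forall>z. nvar st ''o'' \<le> z \<and> z < nvar s ''o'' \<longrightarrow> rarr s ''out_val'' z = fst t $ narr s ''out_idx'' z) \<and>
    (\<forall>z < nvar st ''o''. narr s ''out_idx'' z = narr st ''out_idx'' z \<and>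
       rarr s ''out_val'' z = rarr st ''out_val'' z))"
proof -
  \<comment> \<open>The coordinates emitted after \<open>y\<close> rounds.\<close>
  define A where "A y = idx ` {x. x < y \<and> slot_row t x \<noteq> 0}" for y
  let ?J = "\<lambda>y s. unchanged {''x'', ''o'', ''out_idx'', ''out_val''} st s \<and>
    nvar st ''o'' \<le> nvar s ''o'' \<and>
    bij_betw (narr s ''out_idx'') {nvar st ''o'' ..< nvar s ''o''} (A y) \<and>
    (\<forall>z. nvar st ''o'' \<le> z \<and> z < nvar s ''o'' \<longrightarrow> rarr s ''out_val'' z = fst t $ narr s ''out_idx'' z) \<and>
    (\<forall>z < nvar st ''o''. narr s ''out_idx'' z = narr st ''out_idx'' z \<and>
       rarr s ''out_val'' z = rarr st ''out_val'' z)"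
  have "wp emit_sparse st (\<lambda>t' s. t' \<le> (N + 1) * (24 + 8) \<and> ?J N s)"
    unfolding emit_sparse_def
  proof (rule wp_For[where J = ?J and n = N and T = 24], goal_cases)
    case (4 y s)
    have u: "unchanged {''x'', ''o'', ''out_idx'', ''out_val''} st s" using 4 by blast
    have eqs: "narr s ''in_idx'' = idx" "rarr s ''w'' y = slot_row t y"
      using 4(1) r w by (simp_all add: ready_def unchangedD[OF u] holds_def)
    show ?case
    proof (cases "slot_row t y = 0")
      case True
      then have "A (Suc y) = A y" by (auto simp: A_def less_Suc_eq)
      with True eqs 4 show ?thesis by (simp add: wp_simps unchanged_def)
    next
      case False
      then have set: "A (Suc y) = insert (idx y) (A y)" by (auto simp: A_def less_Suc_eq)
      \<comment> \<open>A coordinate has only one nonzero slot, so it cannot have been emitted before.\<close>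
      have inj: "inj_on idx {x. x < N \<and> slot_row t x \<noteq> 0}"
        using bij_betw_support[OF w(2)] by (rule bij_betw_imp_inj_on)
      have "idx y \<notin> A y"
      proof
        assume "idx y \<in> A y"
        then obtain x where "idx y = idx x" "x < y" "slot_row t x \<noteq> 0" by (auto simp: A_def)
        with inj_onD[OF inj, of y x] False 4(1) show False by simp
      qed
      then have "bij_betw ((narr s ''out_idx'')(nvar s ''o'' := idx y))
          {nvar st ''o'' ..< Suc (nvar s ''o'')} (insert (idx y) (A y))"
        using 4 by (intro bij_betw_append) auto
      then show ?thesis using False eqs 4 slot_row_nonzero[OF 4(1) False]
        by (simp add: wp_simps unchanged_def set less_Suc_eq)
    qed
  qed (use r in \<open>auto simp: unchanged_def ready_def A_def bij_betw_def\<close>)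
  then show ?thesis
  proof (rule wp_mono)
    fix t' s assume 1: "t' \<le> (N + 1) * (24 + 8) \<and> ?J N s"
    have supp: "A N = {l. l < dim_vec (fst t) \<and> fst t $ l \<noteq> 0}"
      using bij_betw_support[OF w(2)] unfolding A_def by (rule bij_betw_imp_surj_on)
    with 1 have "card {nvar st ''o'' ..< nvar s ''o''} = nnz (fst t)"
      unfolding nnz_def by (metis (no_types, lifting) bij_betw_same_card)
    then have "nvar s ''o'' = nvar st ''o'' + nnz (fst t)" using 1 by auto
    with 1 supp show "t' \<le> 40 * (N + k + 1) \<and>
      unchanged {''x'', ''o'', ''out_idx'', ''out_val''} st s \<and>
      nvar s ''o'' = nvar st ''o'' + nnz (fst t) \<and>
      bij_betw (narr s ''out_idx'') {nvar st ''o'' ..< nvar s ''o''}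
        {l. l < dim_vec (fst t) \<and> fst t $ l \<noteq> 0} \<and>
      (\<forall>z. nvar st ''o'' \<le> z \<and> z < nvar s ''o'' \<longrightarrow>
         rarr s ''out_val'' z = fst t $ narr s ''out_idx'' z) \<and>
      (\<forall>z < nvar st ''o''. narr s ''out_idx'' z = narr st ''out_idx'' z \<and>
         rarr s ''out_val'' z = rarr st ''out_val'' z)"
      by auto
  qed
qed

lemma emit_dense_spec:
  assumes r: "ready st" and w: "holds st ''w'' 0 t"
  shows "wp emit_dense st (\<lambda>t' s. t' \<le> 20 * (N + k + 1) \<and> unchanged {''x'', ''out_coef''} st s \<and>
    (\<forall>j < k. rarr s ''out_coef'' (nvar st ''rk'' + j) = snd t $ j) \<and>
    (\<forall>z < nvar st ''rk''. rarr s ''out_coef'' z = rarr st ''out_coef'' z))"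
proof -
  let ?J = "\<lambda>y s. unchanged {''x'', ''out_coef''} st s \<and>
    (\<forall>j < y. rarr s ''out_coef'' (nvar st ''rk'' + j) = snd t $ j) \<and>
    (\<forall>z < nvar st ''rk''. rarr s ''out_coef'' z = rarr st ''out_coef'' z)"
  have "wp emit_dense st (\<lambda>t' s. t' \<le> (k + 1) * (10 + 8) \<and> ?J k s)"
    unfolding emit_dense_def
  proof (rule wp_For[where J = ?J and n = k and T = 10], goal_cases)
    case (4 y s)
    have u: "unchanged {''x'', ''out_coef''} st s" using 4 by blast
    have "nvar s ''rk'' = nvar st ''rk''" "nvar s ''N'' = N" "rarr s ''w'' = rarr st ''w''"
      using r by (simp_all add: ready_def unchangedD[OF u])
    moreover have "rarr st ''w'' (N + y) = snd t $ y" using w 4(1) by (simp add: holds_def slot_row_def)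
    ultimately show ?case using 4
      by (auto simp: wp_simps unchanged_def less_Suc_eq)
  qed (use r in \<open>auto simp: unchanged_def ready_def\<close>)
  then show ?thesis by (rule wp_mono) auto
qed

text \<open>
  The state between two rounds of the main loop: the basis is present twice, in its output format
  and as dense rows in \<open>Q\<close> for the products that follow.
\<close>

definition basis_state :: "svl list \<Rightarrow> state \<Rightarrow> bool" where
  "basis_state qs s \<longleftrightarrow> ready s \<and> svl_stored ''out'' k qs s \<and>
     nvar s ''o'' = narr s ''out_ptr'' (length qs) \<and>
     nvar s ''rk'' = length qs * k \<and> nvar s ''rb'' = length qs * (N + k) \<and>
     (\<forall>p < length qs. holds s ''Q'' (p * (N + k)) (qs ! p))"

text \<open>
  All output is written behind the data of the earlier vectors, which therefore survives.
\<close>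

lemma append_row_spec:
  assumes b: "basis_state qs st" and w: "holds st ''w'' 0 t" "covered t"
    and h: "rvar st ''h'' = svl_inner t t"
  shows "wp append_row st (\<lambda>t' s. t' \<le> 120 * (N + k + 1) \<and>
    unchanged {''x'', ''w'', ''h'', ''Q'', ''rb'', ''rk'', ''o'', ''out_len'', ''out_ptr'', ''out_idx'',
      ''out_val'', ''out_coef''} st s \<and>
    basis_state (qs @ [svl_normalize t]) s)"
  unfolding append_row_def wp_Seq[of "RAssign _ _"] wp_RAssign
proof (rule wp_SeqI[OF normalize_row_spec[where t = t]], goal_cases)
  case 1
  show ?case using b by (simp add: basis_state_def ready_def)
next
  case 2
  show ?case using w by (simp add: holds_def)
next
  case 3
  show ?case by (rule w)
next
  case 4
  show ?case using h by simp
next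
  case (5 t1 s1)
  let ?st = "st\<lparr>rvar := (rvar st)(''h'' := rval (RSqrt (RVar ''h'')) st)\<rparr>"
  let ?q = "svl_normalize t"
    from 5 have u1: "unchanged {''x'', ''w'', ''Q''} ?st s1" by simp
    have r1: "ready s1" using b by (intro ready_unchanged[OF _ u1]) (simp_all add: basis_state_def ready_def)
    have w1: "holds s1 ''w'' 0 ?q" "covered ?q" using 5 w covered_normalize by auto
    show ?case
    proof (rule wp_SeqI[OF emit_sparse_spec[OF r1 w1]], goal_cases)
      case (1 t2 s2)
      note emitted = 1
      then have u2: "unchanged {''x'', ''o'', ''out_idx'', ''out_val''} s1 s2" by simp
      have r2: "ready s2" by (rule ready_unchanged[OF r1 u2]) simp
      have w2: "holds s2 ''w'' 0 ?q" by (rule holds_unchanged[OF w1(1) u2]) simp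
      show ?case
      proof (rule wp_SeqI[OF emit_dense_spec[OF r2 w2]], goal_cases)
        case (1 t3 s3)
        then have u3: "unchanged {''x'', ''out_coef''} s2 s3" by simp
        note u = unchangedD[OF u1] unchangedD[OF u2] unchangedD[OF u3]
        have old: "svl_stored ''out'' k qs st" "nvar st ''o'' = narr st ''out_ptr'' (length qs)"
          "nvar st ''rk'' = length qs * k" "nvar st ''rb'' = length qs * (N + k)"
          "nvar st ''out_len'' = length qs" "nvar st ''out_k'' = k" "nvar st ''L'' = N + k"
          using b by (auto simp: basis_state_def svl_stored_def ready_def)
        let ?s = "s3\<lparr>nvar := (nvar s3)(''out_len'' := Suc (length qs), ''rb'' := length qs * (N + k) + (N + k),
            ''rk'' := length qs * k + k),
          narr := (narr s3)(''out_ptr'' := (narr s3 ''out_ptr'')(Suc (length qs) := nvar s3 ''o''))\<rparr>"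
        have stored: "svl_stored ''out'' k (qs @ [?q]) ?s"
          by (rule svl_stored_snoc[OF old(1), where e = "nvar s3 ''o''"])
            (use emitted[THEN conjunct2] 1 in \<open>auto simp: u old\<close>)
        have Q: "holds ?s ''Q'' (p * (N + k)) ((qs @ [?q]) ! p)" if "p < Suc (length qs)" for p
        proof (cases "p = length qs")
          case True
          then show ?thesis using 5 by (simp add: holds_def u old)
        next
          case False
          then have p: "p < length qs" using that by simp
          have less: "p * (N + k) + x < length qs * (N + k)" if "x < N + k" for x
          proof -
            have "p * (N + k) + x < Suc p * (N + k)" using that by simp
            also have "\<dots> \<le> length qs * (N + k)" using p by (intro mult_le_mono1) simp
            finally show ?thesis .
          qed
          have "holds st ''Q'' (p * (N + k)) (qs ! p)" using b p by (simp add: basis_state_def)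
          then show ?thesis using p less 5 by (simp add: holds_def u old nth_append)
        qed
        have "basis_state (qs @ [?q]) ?s"
          using stored Q r2 by (simp add: basis_state_def ready_def u)
        moreover have "unchanged {''x'', ''w'', ''h'', ''Q'', ''rb'', ''rk'', ''o'', ''out_len'', ''out_ptr'',
            ''out_idx'', ''out_val'', ''out_coef''} st ?s"
          by (simp add: unchanged_def u)
        moreover have "t1 + (t2 + t3) \<le> 90 * (N + k + 1)" using 5 emitted 1 by simp
        ultimately show ?case by (simp add: wp_simps u old)
      qed
    qed
  qed

text \<open>
  One step of Gram-Schmidt. The bound adds the costs of loading, one projection per basis vector, the
  squared norm and the emission, with generous constants; only the factor \<open>length qs + 1\<close> matters
  for the quadratic dependence on the number of tuples.
\<close>

lemma process_row_spec:
  assumes b: "basis_state qs st" and st: "svl_stored ''in'' k ts st" and i: "i < length ts"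
    and N: "narr st ''in_ptr'' (length ts) = N"
    and iv: "nvar st ''i'' = i" "nvar st ''ib'' = i * k"
    and t: "covered (ts ! i)" and qs: "\<forall>q \<in> set qs. covered q"
  shows "wp process_row st (\<lambda>t' s. t' \<le> (length qs + 1) * (320 * (N + k + 1)) \<and>
    unchanged {''x'', ''w'', ''h'', ''p'', ''pb'', ''ib'', ''Q'', ''rb'', ''rk'', ''o'', ''out_len'',
      ''out_ptr'', ''out_idx'', ''out_val'', ''out_coef''} st s \<and>
    nvar s ''ib'' = Suc i * k \<and> basis_state (gs_step qs (ts ! i)) s)"
    (is "wp _ _ (\<lambda>t' s. _ \<and> unchanged ?V st s \<and> _)")
proof -
  let ?v = "foldl svl_reduce (ts ! i) qs"
  have r: "ready st" using b by (simp add: basis_state_def)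
  have v: "covered ?v" using t qs by (rule covered_residual)
  have fst: "fst (ts ! i) \<in> carrier_vec m" using t by (simp add: covered_def)
  \<comment> \<open>Before the emission only scratch memory has been written.\<close>
  have keep: "basis_state qs s"
    if u: "unchanged {''x'', ''w'', ''h'', ''p'', ''pb'', ''ib''} st s" for s
    using b ready_unchanged[OF r u] svl_stored_unchanged[OF _ u, of "''out''" k qs]
    by (simp add: basis_state_def holds_def unchangedD[OF u])
  show ?thesis
    unfolding process_row_def
  proof (rule wp_SeqI[OF load_dense_spec[OF r st i iv(2)]], goal_cases)
    case (1 t1 s1)
    note dense = 1
    then have u1: "unchanged {''x'', ''w''} st s1" by simp
    have st1: "svl_stored ''in'' k ts s1" by (rule svl_stored_unchanged[OF st u1]) simp
    have iv1: "narr s1 ''in_ptr'' (length ts) = N" "nvar s1 ''i'' = i" using N iv by (simp_all add: unchangedD[OF u1])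
    have w1: "\<forall>x < N + k. rarr s1 ''w'' x = (if x < N then 0 else slot_row (ts ! i) x)" using 1 by simp
    have r1: "ready s1" by (rule ready_unchanged[OF r u1]) simp
    show ?case
    proof (rule wp_SeqI[OF load_sparse_spec[OF r1 st1 i iv1(1) fst iv1(2) w1]], goal_cases)
      case (1 t2 s2)
      note 2 = 1
      then have u2: "unchanged {''x'', ''w''} s1 s2" by simp
      let ?s3 = "s2\<lparr>nvar := (nvar s2)(''ib'' := Suc i * k)\<rparr>"
      have u3: "unchanged {''x'', ''w'', ''ib''} st ?s3"
        by (simp add: unchanged_def unchangedD[OF u2] unchangedD[OF u1])
      have ib: "nvar s2 ''ib'' + nvar s2 ''out_k'' = Suc i * k"
        using iv r by (simp add: ready_def unchangedD[OF u2] unchangedD[OF u1])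
      have b3: "basis_state qs ?s3" by (rule keep) (use u3 in \<open>simp add: unchanged_def\<close>)
      then have r3: "ready ?s3" and len3: "nvar ?s3 ''out_len'' = length qs"
        and Q3: "\<forall>p < length qs. holds ?s3 ''Q'' (p * (N + k)) (qs ! p)"
        by (simp_all add: basis_state_def svl_stored_def)
      have w3: "holds ?s3 ''w'' 0 (ts ! i)" using 2 by (simp add: holds_def)
      have "wp (Seq project_row (Seq (dot ''w'' (NLit 0)) (Cond (REq (RVar ''h'') (RLit 0)) Skip append_row)))
        ?s3 (\<lambda>t' s. t' \<le> (length qs + 1) * (80 * (N + k + 1)) + 155 * (N + k + 1) \<and>
          unchanged ?V st s \<and> nvar s ''ib'' = Suc i * k \<and> basis_state (gs_step qs (ts ! i)) s)"
      proof (rule wp_SeqI[OF project_row_spec[OF r3 len3 Q3 qs w3 t]], goal_cases)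
        case (1 t4 s4)
        note 4 = 1
        then have u4: "unchanged {''x'', ''h'', ''w'', ''p'', ''pb''} ?s3 s4" by blast
        have r4: "ready s4" by (rule ready_unchanged[OF r3 u4]) simp
        have w4: "holds s4 ''w'' 0 ?v" using 4 by blast
        have w4': "holds s4 ''w'' (nval (NLit 0) s4) ?v" using w4 by simp
        show ?case
        proof (rule wp_SeqI[OF dot_spec[OF r4 w4' v w4 v]], goal_cases)
          case (5 t5 s5)
          note 5 = 5
          then have u5: "unchanged {''x'', ''h''} s4 s5" by blast
          have u: "unchanged {''x'', ''w'', ''h'', ''p'', ''pb'', ''ib''} st s5"
            using u3 u4 u5 unfolding unchanged_def by simp
          have h5: "rvar s5 ''h'' = svl_inner ?v ?v" using 5 by blast
          have b5: "basis_state qs s5" by (rule keep[OF u])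
          have w5: "holds s5 ''w'' 0 ?v" by (rule holds_unchanged[OF w4 u5]) simp
          have ib5: "nvar s5 ''ib'' = Suc i * k" by (simp add: unchangedD[OF u5] unchangedD[OF u4])
          have time: "t4 + t5 \<le> (length qs + 1) * (80 * (N + k + 1)) + 30 * (N + k + 1)"
            using 4 5 by simp
          show ?case
          proof (cases "svl_inner ?v ?v = 0")
            case True
            have "unchanged ?V st s5" using u by (simp add: unchanged_def)
            then show ?thesis
              using True h5 b5 ib5 time by (simp add: wp_simps gs_step_def)
          next
            case False
            have eq: "gs_step qs (ts ! i) = qs @ [svl_normalize ?v]" using False by (simp add: gs_step_def)
            show ?thesis
              unfolding wp_Cond eq using False h5
              apply simp
              apply (rule wp_mono[OF append_row_spec[OF b5 w5 v h5]])
              apply (use u time ib5 in \<open>auto simp: unchanged_def\<close>)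
              done
          qed
        qed simp_all
      qed
      then show ?case
        unfolding wp_Seq[of "NAssign _ _"] wp_NAssign
        using ib apply simp
        apply (erule wp_mono)
        apply (use dense 2 in \<open>auto simp: algebra_simps\<close>)
        done
    qed
  qed
qed

lemma main_loop_spec:
  assumes b: "basis_state [] st" and ib: "nvar st ''ib'' = 0" and st: "svl_stored ''in'' k ts st"
    and N: "narr st ''in_ptr'' (length ts) = N" and ts: "\<forall>t \<in> set ts. covered t"
  shows "wp (For ''i'' ''in_len'' process_row) st (\<lambda>t s.
    t \<le> (length ts + 1) * (length ts * (320 * (N + k + 1)) + 8) \<and> basis_state (gram_schmidt ts) s)"
proof -
  let ?V = "{''x'', ''w'', ''h'', ''p'', ''pb'', ''ib'', ''Q'', ''rb'', ''rk'', ''o'', ''out_len'',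
      ''out_ptr'', ''out_idx'', ''out_val'', ''out_coef'', ''i''}"
  let ?J = "\<lambda>y s. unchanged ?V st s \<and> nvar s ''ib'' = y * k \<and>
    basis_state (gram_schmidt (take y ts)) s"
  \<comment> \<open>The loop counter is not part of the state between rounds.\<close>
  have cong: "basis_state qs (s\<lparr>nvar := (nvar s)(''i'' := y)\<rparr>)" if b: "basis_state qs s" for qs s y
  proof -
    have u: "unchanged {''i''} s (s\<lparr>nvar := (nvar s)(''i'' := y)\<rparr>)" by (simp add: unchanged_def)
    show ?thesis
      using b ready_unchanged[OF _ u] svl_stored_unchanged[OF _ u, of "''out''" k qs]
      by (simp add: basis_state_def holds_def)
  qed
  have "wp (For ''i'' ''in_len'' process_row) st (\<lambda>t s.
      t \<le> (length ts + 1) * (length ts * (320 * (N + k + 1)) + 8) \<and> ?J (length ts) s)"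
  proof (rule wp_For[where J = ?J and n = "length ts" and T = "length ts * (320 * (N + k + 1))"], goal_cases)
    case 1
    then show ?case using cong[OF b] ib by (simp add: unchanged_def gram_schmidt_def)
  next
    case 2
    then show ?case using st by (simp add: svl_stored_def)
  next
    case 3
    then show ?case by simp
  next
    case (4 y s)
    let ?qs = "gram_schmidt (take y ts)"
    from 4 have u: "unchanged ?V st s" and ib: "nvar s ''ib'' = y * k" and b: "basis_state ?qs s" by auto
    have in': "svl_stored ''in'' k ts s" by (rule svl_stored_unchanged[OF st u]) simp
    have N': "narr s ''in_ptr'' (length ts) = N" using N by (simp add: unchangedD[OF u])
    have t: "covered (ts ! y)" using ts 4(1) by simp
    have qs: "\<forall>q \<in> set ?qs. covered q"
      by (rule covered_gram_schmidt) (use ts in \<open>auto dest: in_set_takeD\<close>)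
    have len: "length ?qs + 1 \<le> length ts" using length_gram_schmidt[of "take y ts"] 4(1) by simp
    have step: "gs_step ?qs (ts ! y) = gram_schmidt (take (Suc y) ts)"
      using 4(1) by (simp add: gram_schmidt_def take_Suc_conv_app_nth)
    show ?case
    proof (rule wp_mono[OF process_row_spec[OF b in' 4(1) N' 4(2) ib t qs]], goal_cases)
      case (1 t s')
      then have u': "unchanged {''x'', ''w'', ''h'', ''p'', ''pb'', ''ib'', ''Q'', ''rb'', ''rk'', ''o'',
          ''out_len'', ''out_ptr'', ''out_idx'', ''out_val'', ''out_coef''} s s'" by simp
      have "t \<le> (length ?qs + 1) * (320 * (N + k + 1))" using 1 by simp
      also have "\<dots> \<le> length ts * (320 * (N + k + 1))" using len by (rule mult_le_mono1)
      finally have "t \<le> length ts * (320 * (N + k + 1))" .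
      moreover have "unchanged ?V st (s'\<lparr>nvar := (nvar s')(''i'' := Suc y)\<rparr>)"
        by (simp add: unchanged_def unchangedD[OF u'] unchangedD[OF u])
      moreover have "basis_state (gram_schmidt (take (Suc y) ts)) (s'\<lparr>nvar := (nvar s')(''i'' := Suc y)\<rparr>)"
        using 1 by (intro cong) (simp add: step)
      ultimately show ?case using 1 4(2,3) by (simp add: unchangedD[OF u'])
    qed
  qed
  then show ?thesis by (rule wp_mono) simp
qed

end

section \<open>Running time and result\<close>

text \<open>
  Here \<open>n = N + k\<close>. Lower order terms are absorbed because \<open>n\<close> and \<open>s\<close> are at least \<open>1\<close> when the
  claimed bound is positive.
\<close>

lemma quadratic_bound:
  fixes s n :: nat
  assumes "0 < s" "0 < n"
  shows "60 + 20 * (n + 1) + (s + 1) * (s * (320 * (n + 1)) + 8) \<le> 2000 * (n * s\<^sup>2)"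
proof -
  have 1: "1 \<le> n * s\<^sup>2" using assms by simp
  have 2: "n \<le> n * s\<^sup>2" using assms by simp
  have 3: "n * s \<le> n * s\<^sup>2" by (simp add: power2_eq_square)
  have 4: "s \<le> n * s" "s\<^sup>2 \<le> n * s\<^sup>2" using assms by simp_all
  have "60 + 20 * (n + 1) + (s + 1) * (s * (320 * (n + 1)) + 8)
      = 88 + 20 * n + 320 * (n * s\<^sup>2) + 320 * s\<^sup>2 + 320 * (n * s) + 328 * s"
    by (simp add: algebra_simps power2_eq_square)
  also have "\<dots> \<le> 2000 * (n * s\<^sup>2)" using 1 2 3 4 by linarith
  finally show ?thesis .
qed

theorem lemma4:
  "\<exists>(prog :: com) (C :: nat).
     \<forall>(m :: nat) (k :: nat) (s :: nat) (U :: real mat) (ts :: svl list) (st :: state).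
       U \<in> carrier_mat m k \<and> transpose_mat U * U = 1\<^sub>m k \<and>
       length ts = s \<and> (\<forall>t \<in> set ts. is_svl U t) \<and> svl_stored ''in'' k ts st \<longrightarrow>
       (\<exists>time st' qs.
          exec prog st time st' \<and>
          svl_stored ''out'' k qs st' \<and>
          svl_orthonormal_basis U qs ts \<and>
          (let bound = ((\<Sum>i<s. nnz (fst (ts ! i))) + k) * s\<^sup>2
           in bound > 0 \<longrightarrow> time \<le> C * bound))"
proof (rule exI[of _ gram_schmidt_prog], rule exI[of _ 2000], intro allI impI, elim conjE)
  fix m k s :: nat and U :: "real mat" and ts :: "svl list" and st :: state
  assume U: "U \<in> carrier_mat m k" "transpose_mat U * U = 1\<^sub>m k" and s: "length ts = s"
    and ts: "\<forall>t \<in> set ts. is_svl U t" and st: "svl_stored ''in'' k ts st"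
  interpret orthonormal_columns U m k by unfold_locales (use U in auto)
  define N where "N = narr st ''in_ptr'' (length ts)"
  have N_sum: "N = (\<Sum>i<s. nnz (fst (ts ! i)))" using stored_ptr[OF st, of "length ts"] s by (simp add: N_def)
  let ?V = "{''N'', ''L'', ''out_k'', ''out_len'', ''rb'', ''rk'', ''ib'', ''o'', ''out_ptr'', ''x'', ''pos''}"
  let ?idx = "narr st ''in_idx''"
  have car: "\<forall>t \<in> set ts. fst t \<in> carrier_vec m" using ts is_svl_carrier(1) by blast
  \<comment> \<open>The array \<open>pos\<close> that instantiates the slots is the one left by the initialisation.\<close>
  have main: "wp (For ''i'' ''in_len'' process_row) s1 (\<lambda>t s'.
      t \<le> (s + 1) * (s * (320 * (N + k + 1)) + 8) \<and> svl_stored ''out'' k (gram_schmidt ts) s')"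
    if u: "unchanged ?V st s1" and vars: "nvar s1 ''N'' = N" "nvar s1 ''L'' = N + k" "nvar s1 ''out_k'' = k"
      "nvar s1 ''out_len'' = 0" "nvar s1 ''rb'' = 0" "nvar s1 ''rk'' = 0" "nvar s1 ''ib'' = 0"
      "nvar s1 ''o'' = 0" "narr s1 ''out_ptr'' 0 = 0"
      and pos: "\<forall>q < N. narr s1 ''pos'' (?idx q) < N \<and> ?idx (narr s1 ''pos'' (?idx q)) = ?idx q" for s1
  proof -
    interpret slots m k N ?idx "narr s1 ''pos''"
      by unfold_locales (use pos stored_idx_less[OF st car] in \<open>simp_all add: N_def\<close>)
    have covered: "\<forall>t \<in> set ts. covered t"
    proof
      fix t assume "t \<in> set ts"
      then obtain i where i: "i < length ts" "t = ts ! i" by (auto simp: in_set_conv_nth)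
      have c: "fst t \<in> carrier_vec m" "snd t \<in> carrier_vec k"
        using is_svl_carrier[of t] ts \<open>t \<in> set ts\<close> by auto
      have "l \<in> ?idx ` {..<N}" if "l < m" "fst t $ l \<noteq> 0" for l
      proof -
        have "l < dim_vec (fst (ts ! i))" "fst (ts ! i) $ l \<noteq> 0" using that c i by auto
        from stored_support[OF st i(1) this] show ?thesis by (auto simp: N_def)
      qed
      with c show "covered t" by (simp add: covered_def)
    qed
    have in1: "svl_stored ''in'' k ts s1" by (rule svl_stored_unchanged[OF st u]) simp
    have "ready s1" using vars by (simp add: ready_def unchangedD[OF u])
    then have b: "basis_state [] s1" using vars by (simp add: basis_state_def svl_stored_def)
    have N1: "narr s1 ''in_ptr'' (length ts) = N" by (simp add: N_def unchangedD[OF u])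
    show ?thesis
      by (rule wp_mono[OF main_loop_spec[OF b vars(7) in1 N1 covered]]) (auto simp: s basis_state_def)
  qed
  have len: "nvar st ''in_len'' = length ts" "nvar st ''in_k'' = k" using st by (simp_all add: svl_stored_def)
  let ?st = "st\<lparr>nvar := (nvar st)(''N'' := N, ''L'' := N + k, ''out_k'' := k, ''out_len'' := 0,
      ''rb'' := 0, ''rk'' := 0, ''ib'' := 0, ''o'' := 0),
    narr := (narr st)(''out_ptr'' := (narr st ''out_ptr'')(0 := 0))\<rparr>"
  have "nvar ?st ''N'' = N" by simp
  note slots = index_slots_spec[OF this]
  have "wp initialise st (\<lambda>t s1. t \<le> 60 + 20 * (N + 1) \<and> unchanged ?V st s1 \<and> nvar s1 ''N'' = N \<and>
      nvar s1 ''L'' = N + k \<and> nvar s1 ''out_k'' = k \<and>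
      nvar s1 ''out_len'' = 0 \<and> nvar s1 ''rb'' = 0 \<and> nvar s1 ''rk'' = 0 \<and> nvar s1 ''ib'' = 0 \<and>
      nvar s1 ''o'' = 0 \<and> narr s1 ''out_ptr'' 0 = 0 \<and>
      (\<forall>q < N. narr s1 ''pos'' (?idx q) < N \<and> ?idx (narr s1 ''pos'' (?idx q)) = ?idx q))"
    unfolding initialise_def
    apply (simp add: wp_simps len N_def[symmetric])
    apply (rule wp_mono[OF slots])
    apply (auto simp: unchanged_def)
    done
  then have "wp gram_schmidt_prog st (\<lambda>t s'.
      t \<le> 60 + 20 * (N + 1) + (s + 1) * (s * (320 * (N + k + 1)) + 8) \<and>
      svl_stored ''out'' k (gram_schmidt ts) s')"
    unfolding gram_schmidt_prog_def
  proof (rule wp_SeqI, goal_cases)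
    case (1 t s1)
    then show ?case by (intro wp_mono[OF main]) auto
  qed
  then obtain time st' where run: "exec gram_schmidt_prog st time st'"
    and time: "time \<le> 60 + 20 * (N + 1) + (s + 1) * (s * (320 * (N + k + 1)) + 8)"
    and out: "svl_stored ''out'' k (gram_schmidt ts) st'"
    unfolding wp_def by blast
  have "0 < (N + k) * s\<^sup>2 \<longrightarrow> time \<le> 2000 * ((N + k) * s\<^sup>2)"
  proof
    assume "0 < (N + k) * s\<^sup>2"
    then have "0 < s" "0 < N + k" by auto
    from quadratic_bound[OF this] time show "time \<le> 2000 * ((N + k) * s\<^sup>2)" by simp
  qed
  with run out gram_schmidt_orthonormal_basis[OF ts] show "\<exists>time st' qs.
      exec gram_schmidt_prog st time st' \<and> svl_stored ''out'' k qs st' \<and>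
      svl_orthonormal_basis U qs ts \<and>
      (let bound = ((\<Sum>i<s. nnz (fst (ts ! i))) + k) * s\<^sup>2
       in bound > 0 \<longrightarrow> time \<le> 2000 * bound)"
    unfolding N_sum Let_def by (intro exI conjI) auto
qed

end
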